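(* Let $\kappa>0$, $\tau\neq0$, $\kappa\neq4\tau^2$ and $H>0$. Let $a=\arctan(\sqrt\kappa/2H)$ and let $y$ be the function $$y(x)=\begin{cases}-\arctan\left(\frac{\tau}{H}\lambda(x)\right)+\frac{H}{\tau}\frac{\sqrt{4\tau^2-\kappa}}{\sqrt{4H^2+\kappa}}\arctan\left(\frac{\sqrt{4\tau^2-\kappa}}{\sqrt{4H^2+\kappa}}\lambda(x)\right)&\text{if }\kappa-4\tau^2<0,\\[2mm]-\arctan\left(\frac{\tau}{H}\lambda(x)\right)-\frac{H}{\tau}\frac{\sqrt{\kappa-4\tau^2}}{\sqrt{4H^2+\kappa}}\operatorname{arctanh}\left(\frac{\sqrt{\kappa-4\tau^2}}{\sqrt{4H^2+\kappa}}\lambda(x)\right)&\text{if }\kappa-4\tau^2>0,\end{cases}$$ where $\lambda(x)=\sqrt{1-\frac{4H^2}{\kappa}\tan^2x}\Big/\sqrt{1+\frac{4\tau^2}{\kappa}\tan^2x}$, $x\in[0,a]$. Let $\Phi:\,]-a,a[\,\times\,]-\pi,\pi[\ \to\mathbb{S}^3_b(\kappa,\tau)$ be the immersion given by $$\Phi(x,t)=\begin{cases}\left(\cos(x+a)e^{iy(x+a)},\ \sin(x+a)e^{it}\right)&\text{if }x<0,\\ \left(\cos(a-x)e^{-iy(a-x)},\ \sin(a-x)e^{it}\right)&\text{if }x\ge0.\end{cases}$$ Then $\Phi$ defines an immersion of a sphere with constant mean curvature $H$. Moreover, $\Phi$ is an embedding if and only if $y(0)>-\pi$.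
   Context: $\mathbb{S}^3_b(\kappa,\tau)$ (Berger sphere) is $\mathbb{S}^3=\{(z,w)\in\mathbb{C}^2:|z|^2+|w|^2=1\}$ with the metric $g(X,Y)=\frac4\kappa\left[\langle X,Y\rangle+\left(\frac{4\tau^2}{\kappa}-1\right)\langle X,V\rangle\langle Y,V\rangle\right]$, where $\langle\,,\rangle$ is the standard round metric and $V_{(z,w)}=(iz,iw)$. Mean curvature is half the trace of the second fundamental form.
   Formalization: For τ<0 the criterion y(0)>-π always holds, yet Φ can fail to be an embedding (κ=4, τ=-1/10, H=1: y(0)≈6.25>π); there it is replaced by y(0)<π. For τ>0 it is as stated. Φ is read as the sphere immersion it extends to, since it is not differentiable at x=0. *)

theory Defs
  imports "HOL-Analysis.Analysis"
begin

section \<open>Smooth maps on the unit sphere\<close>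

text \<open>\<open>U\<close> is open in all uses.\<close>

fun Ck_on :: "nat \<Rightarrow> 'a::euclidean_space set \<Rightarrow> ('a \<Rightarrow> 'b::real_normed_vector) \<Rightarrow> bool" where
  "Ck_on 0 U f \<longleftrightarrow> continuous_on U f"
| "Ck_on (Suc k) U f \<longleftrightarrow>
     (\<forall>x\<in>U. f differentiable (at x)) \<and> (\<forall>v. Ck_on k U (\<lambda>x. frechet_derivative f (at x) v))"

definition smooth_on_open :: "'a::euclidean_space set \<Rightarrow> ('a \<Rightarrow> 'b::real_normed_vector) \<Rightarrow> bool" where
  "smooth_on_open U f \<longleftrightarrow> open U \<and> (\<forall>k. Ck_on k U f)"

abbreviation S2 :: "(complex \<times> real) set" where
  "S2 \<equiv> sphere 0 1"

abbreviation S3 :: "(complex \<times> complex) set" where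
  "S3 \<equiv> {(z, w). (cmod z)\<^sup>2 + (cmod w)\<^sup>2 = 1}"

definition tangent_space :: "'a::real_inner \<Rightarrow> 'a set" where
  "tangent_space p = {u. p \<bullet> u = 0}"

text \<open>A map on the sphere is represented by a function on the surrounding space that is smooth near
  the sphere. Its derivative is only ever applied to vectors tangent to the sphere, where it does
  not depend on the chosen extension.\<close>

definition smooth_on_S2 :: "(complex \<times> real \<Rightarrow> 'b::real_normed_vector) \<Rightarrow> bool" where
  "smooth_on_S2 F \<longleftrightarrow> (\<exists>U. S2 \<subseteq> U \<and> smooth_on_open U F)"

abbreviation dif :: "('a::real_normed_vector \<Rightarrow> 'b::real_normed_vector) \<Rightarrow> 'a \<Rightarrow> 'a \<Rightarrow> 'b" where
  "dif F q \<equiv> frechet_derivative F (at q)"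

definition sphere_immersion :: "(complex \<times> real \<Rightarrow> complex \<times> complex) \<Rightarrow> bool" where
  "sphere_immersion F \<longleftrightarrow>
     smooth_on_S2 F \<and> F ` S2 \<subseteq> S3 \<and> (\<forall>q\<in>S2. inj_on (dif F q) (tangent_space q))"

definition sphere_embedding :: "(complex \<times> real \<Rightarrow> complex \<times> complex) \<Rightarrow> bool" where
  "sphere_embedding F \<longleftrightarrow> sphere_immersion F \<and> (\<exists>G. homeomorphism S2 (F ` S2) F G)"


section \<open>The Berger metric and its Levi-Civita connection\<close>

definition hopf_field :: "complex \<times> complex \<Rightarrow> complex \<times> complex" where
  "hopf_field p = (\<i> * fst p, \<i> * snd p)"

definition berger_metric ::
  "real \<Rightarrow> real \<Rightarrow> complex \<times> complex \<Rightarrow> complex \<times> complex \<Rightarrow> complex \<times> complex \<Rightarrow> real" where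
  "berger_metric \<kappa> \<tau> p X Y =
     4 / \<kappa> * (X \<bullet> Y + (4 * \<tau>\<^sup>2 / \<kappa> - 1) * (X \<bullet> hopf_field p) * (Y \<bullet> hopf_field p))"

text \<open>For \<open>X\<close>, \<open>Z\<close> tangent to the three-sphere at \<open>p\<close>, \<open>levi_civita \<kappa> \<tau> p X Y Y' Z\<close> is
  \<open>g(\<nabla>\<^sub>X Y, Z)\<close>, where the tangent field is given by its value \<open>Y\<close> at \<open>p\<close> and its ordinary
  directional derivative \<open>Y'\<close> along \<open>X\<close> in the surrounding vector space. The three derivatives of
  the metric (with constant arguments, using the same formula for the metric off the sphere) are the
  Christoffel symbols of the first kind. Lemma \<open>levi_civita_koszul\<close> below is the Koszul formula.\<close>

definition levi_civita ::
  "real \<Rightarrow> real \<Rightarrow> complex \<times> complex \<Rightarrow> complex \<times> complex \<Rightarrow> complex \<times> complex \<Rightarrow> complex \<times> complex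
    \<Rightarrow> complex \<times> complex \<Rightarrow> real" where
  "levi_civita \<kappa> \<tau> p X Y Y' Z =
     berger_metric \<kappa> \<tau> p Y' Z
     + (dif (\<lambda>q. berger_metric \<kappa> \<tau> q Y Z) p X
        + dif (\<lambda>q. berger_metric \<kappa> \<tau> q X Z) p Y
        - dif (\<lambda>q. berger_metric \<kappa> \<tau> q X Y) p Z) / 2"

lemma hopf_field_linear: "bounded_linear hopf_field"
  unfolding hopf_field_def
  by (intro bounded_linear_Pair bounded_linear_mult_right[THEN bounded_linear_compose]
      bounded_linear_fst bounded_linear_snd)

lemma berger_metric_commute: "berger_metric \<kappa> \<tau> p X Y = berger_metric \<kappa> \<tau> p Y X"
  by (simp add: berger_metric_def inner_commute mult_ac)

lemma berger_metric_diff: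
  "berger_metric \<kappa> \<tau> p (X - Y) Z = berger_metric \<kappa> \<tau> p X Z - berger_metric \<kappa> \<tau> p Y Z"
  by (simp only: berger_metric_def inner_diff_left algebra_simps)

lemma berger_metric_field_derivative:
  assumes "(Y has_derivative Y') (at p)" "(Z has_derivative Z') (at p)"
  shows "((\<lambda>q. berger_metric \<kappa> \<tau> q (Y q) (Z q)) has_derivative
     (\<lambda>h. 4 / \<kappa> * (Y p \<bullet> Z' h + Y' h \<bullet> Z p + (4 * \<tau>\<^sup>2 / \<kappa> - 1) *
        ((Y p \<bullet> hopf_field p) * (Z p \<bullet> hopf_field h + Z' h \<bullet> hopf_field p)
         + (Y p \<bullet> hopf_field h + Y' h \<bullet> hopf_field p) * (Z p \<bullet> hopf_field p))))) (at p)"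
proof -
  have V: "(hopf_field has_derivative hopf_field) (at p)"
    by (rule bounded_linear_imp_has_derivative[OF hopf_field_linear])
  show ?thesis
    unfolding berger_metric_def
    by (rule derivative_eq_intros assms V refl | simp only: mult_zero_left mult_zero_right)+
      (simp only: algebra_simps)
qed

lemma dif_berger_metric_field:
  assumes "(Y has_derivative Y') (at p)" "(Z has_derivative Z') (at p)"
  shows "dif (\<lambda>q. berger_metric \<kappa> \<tau> q (Y q) (Z q)) p W =
    dif (\<lambda>q. berger_metric \<kappa> \<tau> q (Y p) (Z p)) p W
    + berger_metric \<kappa> \<tau> p (Y' W) (Z p) + berger_metric \<kappa> \<tau> p (Y p) (Z' W)"
proof -
  note d = berger_metric_field_derivative[THEN frechet_derivative_at, symmetric]
  have c: "\<And>c. ((\<lambda>q. c) has_derivative (\<lambda>h. 0)) (at p)" by simp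
  show ?thesis
    unfolding d[OF assms] d[OF c c]
    by (simp only: berger_metric_def algebra_simps inner_zero_left inner_zero_right mult_1
        mult_zero_left mult_zero_right add_0_left add_0_right)
qed

lemma levi_civita_koszul:
  assumes "(X has_derivative X') (at p)" "(Y has_derivative Y') (at p)" "(Z has_derivative Z') (at p)"
  shows "2 * levi_civita \<kappa> \<tau> p (X p) (Y p) (Y' (X p)) (Z p) =
      dif (\<lambda>q. berger_metric \<kappa> \<tau> q (Y q) (Z q)) p (X p)
    + dif (\<lambda>q. berger_metric \<kappa> \<tau> q (X q) (Z q)) p (Y p)
    - dif (\<lambda>q. berger_metric \<kappa> \<tau> q (X q) (Y q)) p (Z p)
    + berger_metric \<kappa> \<tau> p (Y' (X p) - X' (Y p)) (Z p)
    - berger_metric \<kappa> \<tau> p (Z' (X p) - X' (Z p)) (Y p)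
    - berger_metric \<kappa> \<tau> p (Z' (Y p) - Y' (Z p)) (X p)"
proof -
  have arith: "2 * (a + (d1 + d2 - d3) / 2) = d1 + a + b + (d2 + c + e) - (d3 + f + k)
      + (a - c) - (b - f) - (e - k)" for a b c e f k d1 d2 d3 :: real
    by simp
  show ?thesis
    unfolding dif_berger_metric_field[OF assms(2,3)] dif_berger_metric_field[OF assms(1,3)]
      dif_berger_metric_field[OF assms(1,2)] levi_civita_def berger_metric_diff
      berger_metric_commute[of \<kappa> \<tau> p "Y p" "Z' (X p)"]
      berger_metric_commute[of \<kappa> \<tau> p "X p" "Z' (Y p)"]
      berger_metric_commute[of \<kappa> \<tau> p "X p" "Y' (Z p)"]
    by (rule arith)
qed


section \<open>Mean curvature\<close>

definition unit_normal ::
  "real \<Rightarrow> real \<Rightarrow> (complex \<times> real \<Rightarrow> complex \<times> complex) \<Rightarrow> (complex \<times> real \<Rightarrow> complex \<times> complex) \<Rightarrow> bool"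
  where
  "unit_normal \<kappa> \<tau> F N \<longleftrightarrow>
     smooth_on_S2 N \<and>
     (\<forall>q\<in>S2. N q \<in> tangent_space (F q) \<and> berger_metric \<kappa> \<tau> (F q) (N q) (N q) = 1 \<and>
        (\<forall>u\<in>tangent_space q. berger_metric \<kappa> \<tau> (F q) (N q) (dif F q u) = 0))"

text \<open>\<open>II(u, v) = - g(\<nabla>\<^sub>u N, dF v)\<close>, for \<open>u\<close>, \<open>v\<close> tangent to \<open>S2\<close> at \<open>q\<close>.\<close>

definition second_fundamental_form ::
  "real \<Rightarrow> real \<Rightarrow> (complex \<times> real \<Rightarrow> complex \<times> complex) \<Rightarrow> (complex \<times> real \<Rightarrow> complex \<times> complex)
    \<Rightarrow> complex \<times> real \<Rightarrow> complex \<times> real \<Rightarrow> complex \<times> real \<Rightarrow> real" where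
  "second_fundamental_form \<kappa> \<tau> F N q u v =
     - levi_civita \<kappa> \<tau> (F q) (dif F q u) (N q) (dif N q u) (dif F q v)"

definition orthonormal_frame ::
  "real \<Rightarrow> real \<Rightarrow> (complex \<times> real \<Rightarrow> complex \<times> complex) \<Rightarrow> complex \<times> real
    \<Rightarrow> complex \<times> real \<Rightarrow> complex \<times> real \<Rightarrow> bool" where
  "orthonormal_frame \<kappa> \<tau> F q u v \<longleftrightarrow>
     u \<in> tangent_space q \<and> v \<in> tangent_space q \<and>
     berger_metric \<kappa> \<tau> (F q) (dif F q u) (dif F q u) = 1 \<and>
     berger_metric \<kappa> \<tau> (F q) (dif F q v) (dif F q v) = 1 \<and>
     berger_metric \<kappa> \<tau> (F q) (dif F q u) (dif F q v) = 0"

text \<open>The trace of the second fundamental form is the sum of its diagonal entries in any orthonormal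
  frame of the induced metric; such frames exist at every point when \<open>F\<close> is an immersion.
  The orientation is not prescribed, so \<open>N\<close> is one of the two global unit normals.\<close>

definition has_constant_mean_curvature ::
  "real \<Rightarrow> real \<Rightarrow> (complex \<times> real \<Rightarrow> complex \<times> complex) \<Rightarrow> real \<Rightarrow> bool" where
  "has_constant_mean_curvature \<kappa> \<tau> F H \<longleftrightarrow>
     (\<exists>N. unit_normal \<kappa> \<tau> F N \<and>
        (\<forall>q\<in>S2. \<forall>u v. orthonormal_frame \<kappa> \<tau> F q u v \<longrightarrow>
           (second_fundamental_form \<kappa> \<tau> F N q u u + second_fundamental_form \<kappa> \<tau> F N q v v) / 2 = H))"


section \<open>The rotationally invariant parametrization\<close>

definition a_bound :: "real \<Rightarrow> real \<Rightarrow> real" where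
  "a_bound \<kappa> H = arctan (sqrt \<kappa> / (2 * H))"

definition lam :: "real \<Rightarrow> real \<Rightarrow> real \<Rightarrow> real \<Rightarrow> real" where
  "lam \<kappa> \<tau> H x =
     sqrt (1 - 4 * H\<^sup>2 / \<kappa> * (tan x)\<^sup>2) / sqrt (1 + 4 * \<tau>\<^sup>2 / \<kappa> * (tan x)\<^sup>2)"

definition y_profile :: "real \<Rightarrow> real \<Rightarrow> real \<Rightarrow> real \<Rightarrow> real" where
  "y_profile \<kappa> \<tau> H x =
     (if \<kappa> - 4 * \<tau>\<^sup>2 < 0 then
        - arctan (\<tau> / H * lam \<kappa> \<tau> H x)
        + H / \<tau> * (sqrt (4 * \<tau>\<^sup>2 - \<kappa>) / sqrt (4 * H\<^sup>2 + \<kappa>))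
          * arctan (sqrt (4 * \<tau>\<^sup>2 - \<kappa>) / sqrt (4 * H\<^sup>2 + \<kappa>) * lam \<kappa> \<tau> H x)
      else
        - arctan (\<tau> / H * lam \<kappa> \<tau> H x)
        - H / \<tau> * (sqrt (\<kappa> - 4 * \<tau>\<^sup>2) / sqrt (4 * H\<^sup>2 + \<kappa>))
          * artanh (sqrt (\<kappa> - 4 * \<tau>\<^sup>2) / sqrt (4 * H\<^sup>2 + \<kappa>) * lam \<kappa> \<tau> H x))"

definition Phi :: "real \<Rightarrow> real \<Rightarrow> real \<Rightarrow> real \<times> real \<Rightarrow> complex \<times> complex" where
  "Phi \<kappa> \<tau> H = (\<lambda>(x, t).
     let a = a_bound \<kappa> H; y = y_profile \<kappa> \<tau> H in
     if x < 0 then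
       (of_real (cos (x + a)) * exp (\<i> * of_real (y (x + a))),
        of_real (sin (x + a)) * exp (\<i> * of_real t))
     else
       (of_real (cos (a - x)) * exp (- (\<i> * of_real (y (a - x)))),
        of_real (sin (a - x)) * exp (\<i> * of_real t)))"

text \<open>Rotational coordinates on the sphere minus a closed meridian: \<open>t\<close> is the longitude and
  \<open>h x\<close> the height.\<close>

definition sphere_coords :: "(real \<Rightarrow> real) \<Rightarrow> real \<times> real \<Rightarrow> complex \<times> real" where
  "sphere_coords h = (\<lambda>(x, t). (of_real (sqrt (1 - (h x)\<^sup>2)) * exp (\<i> * of_real t), h x))"

text \<open>\<open>F\<close> is an immersion of the whole sphere that is given by \<open>\<Phi>\<close> in coordinates \<open>(x, t)\<close>.
  At \<open>x = 0\<close> the function \<open>y (a - \<bar>x\<bar>)\<close> behaves like a multiple of the square root of \<open>\<bar>x\<bar>\<close>, so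
  there \<open>(x, t)\<close> is only a topological chart of the surface; elsewhere it is a smooth one.\<close>

definition sphere_immersion_given_by ::
  "real \<Rightarrow> (real \<times> real \<Rightarrow> complex \<times> complex) \<Rightarrow> (complex \<times> real \<Rightarrow> complex \<times> complex) \<Rightarrow> bool" where
  "sphere_immersion_given_by a \<Phi> F \<longleftrightarrow>
     sphere_immersion F \<and>
     (\<exists>h. (\<exists>k. homeomorphism {-a<..<a} {-1<..<1} h k) \<and>
          smooth_on_open ({-a<..<a} - {0}) h \<and> (\<forall>x\<in>{-a<..<a} - {0}. deriv h x \<noteq> 0) \<and>
          (\<forall>x\<in>{-a<..<a}. \<forall>t\<in>{-pi<..<pi}. \<Phi> (x, t) = F (sphere_coords h (x, t))))"

end

theory Submission
  imports Defs
begin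

text \<open>Take \<open>h = \<plusminus>\<lambda>\<close>, with the sign of \<open>x\<close>, as height on the sphere. Then \<open>tan\<^sup>2 (a - \<bar>x\<bar>)\<close> is a rational
  function of \<open>h\<^sup>2\<close> and \<open>y\<close> becomes an odd smooth function \<open>Y\<close> of \<open>h\<close>, so that \<open>\<Phi>\<close> extends to the map
  \<open>F (\<zeta>, h) = (2 (H + i \<tau> h) E h, \<surd>\<kappa> s h \<zeta>)\<close> with \<open>s = 1 / \<surd>D\<close>, \<open>E = s exp (- i \<beta>)\<close>,
  \<open>D = 4 H\<^sup>2 + \<kappa> + (4 \<tau>\<^sup>2 - \<kappa>) h\<^sup>2\<close> and \<open>\<beta>' = (H / \<tau>) (4 \<tau>\<^sup>2 - \<kappa>) / D\<close>, which is smooth across the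
  equator \<open>h = 0\<close>. A unit normal is again a polynomial in \<open>h\<close>, \<open>s\<close> and \<open>E\<close>, and the mean curvature
  is an algebraic identity.

  The two sheets \<open>\<plusminus>h\<close> can only meet each other, and do so exactly where \<open>Y h\<close> is a multiple of \<open>\<pi>\<close>. As
  \<open>Y' = - \<kappa> H (H\<^sup>2 + \<tau>\<^sup>2) / (\<tau> (H\<^sup>2 + \<tau>\<^sup>2 h\<^sup>2) D)\<close> has constant sign and \<open>Y 0 = 0\<close>, this happens for some
  \<open>0 < h \<le> 1\<close> iff \<open>\<bar>Y 1\<bar> \<ge> \<pi>\<close>, where \<open>Y 1 = y 0\<close>.\<close>

section \<open>Calculus of \<open>C\<^sup>k\<close> maps\<close>

text \<open>On an open set, functions that agree have the same \<open>has_derivative\<close>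
  relation at every point, so the claim passes to directional derivatives by induction on the
  order.\<close>

lemma Ck_on_cong:
  assumes "open U" "\<And>x. x \<in> U \<Longrightarrow> f x = g x"
  shows "Ck_on k U f = Ck_on k U g"
  using assms(2)
proof (induction k arbitrary: f g)
  case 0
  then show ?case by (simp cong: continuous_on_cong)
next
  case (Suc k)
  have iff: "(f has_derivative d) (at x) \<longleftrightarrow> (g has_derivative d) (at x)" if "x \<in> U" for x d
    using has_derivative_transform_within_open[OF _ assms(1) that] Suc.prems by metis
  \<comment> \<open>\<open>frechet_derivative\<close> is a choice from the
    \<open>has_derivative\<close> relation; equal relations give the same choice even where no
    derivative exists.\<close>
  have "frechet_derivative f (at x) = frechet_derivative g (at x)" if "x \<in> U" for x
    unfolding frechet_derivative_def iff[OF that] ..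
  moreover have "f differentiable (at x) \<longleftrightarrow> g differentiable (at x)" if "x \<in> U" for x
    unfolding differentiable_def iff[OF that] ..
  ultimately show ?case
    using Suc.IH[of "\<lambda>x. frechet_derivative f (at x) v" "\<lambda>x. frechet_derivative g (at x) v" for v]
    by auto
qed

text \<open>The working form of the recursion: an explicit derivative \<open>f'\<close> replaces
  \<open>frechet_derivative\<close>, so the next order is checked on a formula.\<close>

lemma Ck_on_SucI:
  assumes "open U" "\<And>x. x \<in> U \<Longrightarrow> (f has_derivative f' x) (at x)"
    "\<And>v. Ck_on k U (\<lambda>x. f' x v)"
  shows "Ck_on (Suc k) U f"
proof -
  have "frechet_derivative f (at x) = f' x" if "x \<in> U" for x
    using frechet_derivative_at[OF assms(2)[OF that]] by simp
  then have "Ck_on k U (\<lambda>x. frechet_derivative f (at x) v) = Ck_on k U (\<lambda>x. f' x v)" for v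
    by (intro Ck_on_cong assms(1)) simp
  then show ?thesis
    using assms(2,3) by (auto simp: differentiable_def)
qed

lemma Ck_on_pred: "Ck_on (Suc k) U f \<Longrightarrow> Ck_on k U f"
proof (induction k arbitrary: f)
  case 0
  then show ?case
    by (auto intro!: continuous_at_imp_continuous_on differentiable_imp_continuous_within)
qed auto

lemma Ck_on_has_derivative:
  "Ck_on (Suc k) U f \<Longrightarrow> x \<in> U \<Longrightarrow> (f has_derivative frechet_derivative f (at x)) (at x)"
  by (simp add: frechet_derivative_works)

lemma Ck_on_const: "open U \<Longrightarrow> Ck_on k U (\<lambda>x. c)"
proof (induction k arbitrary: c)
  case (Suc k)
  show ?case
    by (rule Ck_on_SucI[where f' = "\<lambda>_ _. 0"]) (auto simp: Suc)
qed simp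

lemma Ck_on_linear:
  assumes "open U" "bounded_linear f"
  shows "Ck_on k U f"
proof (cases k)
  case 0
  then show ?thesis using assms(2) by (simp add: linear_continuous_on)
next
  case (Suc j)
  show ?thesis
    unfolding Suc by (rule Ck_on_SucI[where f' = "\<lambda>_. f"])
      (auto intro: assms bounded_linear_imp_has_derivative Ck_on_const)
qed

lemma Ck_on_add:
  "open U \<Longrightarrow> Ck_on k U f \<Longrightarrow> Ck_on k U g \<Longrightarrow> Ck_on k U (\<lambda>x. f x + g x)"
proof (induction k arbitrary: f g)
  case 0
  then show ?case by (auto intro: continuous_intros)
next
  case (Suc k)
  show ?case
    by (rule Ck_on_SucI[where f' = "\<lambda>x v. dif f x v + dif g x v"])
      (use Suc.prems in \<open>auto intro!: has_derivative_add Ck_on_has_derivative Suc.IH\<close>)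
qed

text \<open>By the Leibniz rule a directional derivative of the product is a sum of two products, in
  which the undifferentiated factor is lowered by one order with \<open>Ck_on_pred\<close>.\<close>

lemma Ck_on_bilinear:
  assumes "bounded_bilinear p"
  shows "open U \<Longrightarrow> Ck_on k U f \<Longrightarrow> Ck_on k U g \<Longrightarrow> Ck_on k U (\<lambda>x. p (f x) (g x))"
proof (induction k arbitrary: f g)
  case 0
  then show ?case by (auto intro: bounded_bilinear.continuous_on[OF assms])
next
  case (Suc k)
  show ?case
  proof (rule Ck_on_SucI[where f' = "\<lambda>x v. p (f x) (dif g x v) + p (dif f x v) (g x)"])
    show "((\<lambda>x. p (f x) (g x)) has_derivative (\<lambda>v. p (f x) (dif g x v) + p (dif f x v) (g x))) (at x)"
      if "x \<in> U" for x
      using Suc.prems that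
      by (intro bounded_bilinear.FDERIV[OF assms] Ck_on_has_derivative)
    show "Ck_on k U (\<lambda>x. p (f x) (dif g x v) + p (dif f x v) (g x))" for v
      using Suc.prems Ck_on_pred[OF Suc.prems(2)] Ck_on_pred[OF Suc.prems(3)]
      by (intro Ck_on_add Suc.IH) auto
  qed (fact Suc.prems)
qed

lemmas Ck_on_mult = Ck_on_bilinear[OF bounded_bilinear_mult]
lemmas Ck_on_scaleR = Ck_on_bilinear[OF bounded_bilinear_scaleR]

lemma Ck_on_power:
  fixes f :: "'a::euclidean_space \<Rightarrow> 'b::real_normed_field"
  shows "open U \<Longrightarrow> Ck_on k U f \<Longrightarrow> Ck_on k U (\<lambda>x. f x ^ n)"
  by (induction n) (auto intro: Ck_on_const Ck_on_mult)

lemma Ck_on_linear_compose: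
  assumes "bounded_linear l"
  shows "open U \<Longrightarrow> Ck_on k U f \<Longrightarrow> Ck_on k U (\<lambda>x. l (f x))"
proof (induction k arbitrary: f)
  case 0
  then show ?case
    by (auto intro: bounded_linear.continuous_on[OF assms])
next
  case (Suc k)
  show ?case
    by (rule Ck_on_SucI[where f' = "\<lambda>x v. l (dif f x v)"])
      (use Suc.prems in \<open>auto intro!: bounded_linear.has_derivative[OF assms] Ck_on_has_derivative Suc.IH\<close>)
qed

lemma Ck_on_Pair:
  "open U \<Longrightarrow> Ck_on k U f \<Longrightarrow> Ck_on k U g \<Longrightarrow> Ck_on k U (\<lambda>x. (f x, g x))"
proof (induction k arbitrary: f g)
  case 0
  then show ?case by (auto intro: continuous_intros)
next
  case (Suc k)
  show ?case
    by (rule Ck_on_SucI[where f' = "\<lambda>x v. (dif f x v, dif g x v)"])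
      (use Suc.prems in \<open>auto intro!: has_derivative_Pair Ck_on_has_derivative Suc.IH\<close>)
qed

lemma Ck_on_SucI_real:
  fixes f :: "real \<Rightarrow> real"
  assumes "open U" "\<And>x. x \<in> U \<Longrightarrow> (f has_real_derivative f' x) (at x)" "Ck_on k U f'"
  shows "Ck_on (Suc k) U f"
  by (rule Ck_on_SucI[where f' = "\<lambda>x v. f' x * v"])
    (use assms in \<open>auto simp: has_field_derivative_def intro: Ck_on_mult Ck_on_const\<close>)

lemmas Ck_on_intros = Ck_on_const Ck_on_add Ck_on_mult Ck_on_scaleR Ck_on_power Ck_on_Pair

section \<open>Rotational spheres and their fibres\<close>

text \<open>Continuing \<open>h\<close> by lines of slope one gives a strictly increasing surjection
  of the real line, and such a map is continuous. The limits of \<open>h\<close> at the ends are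
  thus never computed.\<close>

lemma increasing_homeomorphism_extends:
  fixes h :: "real \<Rightarrow> real"
  assumes a: "a > 0" and mono: "strict_mono_on {-a<..<a} h" and im: "h ` {-a<..<a} = {-1<..<1}"
  obtains g where "continuous_on {-a..a} g" "bij_betw g {-a..a} {-1..1}"
    "\<forall>x\<in>{-a<..<a}. g x = h x" "\<forall>x\<in>{-a..a}. \<bar>g x\<bar> = 1 \<longleftrightarrow> \<bar>x\<bar> = a"
proof -
  define g where "g x = (if x \<le> -a then x + a - 1 else if x \<ge> a then x - a + 1 else h x)" for x
  have h: "h x \<in> {-1<..<1}" if "x \<in> {-a<..<a}" for x using im that by blast
  have mono': "strict_mono g"
  proof (rule strict_monoI)
    fix x y :: real assume "x < y"
    then show "g x < g y"
      using h[of x] h[of y] strict_mono_onD[OF mono, of x y] a unfolding g_def by auto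
  qed
  have "y \<in> range g" for y
  proof (cases "\<bar>y\<bar> < 1")
    case True
    then have "y \<in> h ` {-a<..<a}" unfolding im by auto
    then obtain x where "x \<in> {-a<..<a}" "y = h x" by blast
    then show ?thesis by (intro image_eqI[of _ _ x]) (auto simp: g_def)
  next
    case False
    then have "y = g (if y < 0 then y - a + 1 else y + a - 1)"
      using a by (auto simp: g_def)
    then show ?thesis by blast
  qed
  then have range: "range g = UNIV" by blast
  have "continuous_on UNIV g"
    using strict_mono_leD[OF mono'] by (intro continuous_onI_mono) (simp_all add: range)
  moreover have "g ` {-a..a} = {-1..1}"
  proof -
    have ends: "g a = 1" "g (-a) = -1" using a by (auto simp: g_def)
    have "g x \<in> {-1..1} \<longleftrightarrow> x \<in> {-a..a}" for x
      using strict_mono_less_eq[OF mono', of "-a" x] strict_mono_less_eq[OF mono', of x a] ends by auto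
    then show ?thesis using surjD[OF range] by (fastforce simp: image_iff)
  qed
  ultimately show thesis
  proof (intro that)
    show "bij_betw g {-a..a} {-1..1}"
      using \<open>g ` {-a..a} = {-1..1}\<close> strict_mono_imp_inj_on[OF mono'] by (auto simp: bij_betw_def intro: inj_on_subset)
    have "\<bar>g x\<bar> = 1 \<longleftrightarrow> \<bar>x\<bar> = a" if "x \<in> {-a..a}" for x
      using that h[of x] a unfolding g_def by auto
    then show "\<forall>x\<in>{-a..a}. \<bar>g x\<bar> = 1 \<longleftrightarrow> \<bar>x\<bar> = a" by blast
  qed (auto intro: continuous_on_subset simp: g_def)
qed

text \<open>A continuous injection of an interval is strictly monotone; the decreasing case is
  reduced to \<open>- h\<close>.\<close>

lemma homeomorphism_interval_extends:
  fixes h :: "real \<Rightarrow> real"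
  assumes a: "a > 0" and homeo: "homeomorphism {-a<..<a} {-1<..<1} h k"
  obtains g where "continuous_on {-a..a} g" "bij_betw g {-a..a} {-1..1}"
    "\<forall>x\<in>{-a<..<a}. g x = h x" "\<forall>x\<in>{-a..a}. \<bar>g x\<bar> = 1 \<longleftrightarrow> \<bar>x\<bar> = a"
proof -
  have cont: "continuous_on {-a<..<a} h" and im: "h ` {-a<..<a} = {-1<..<1}"
    using homeo by (auto simp: homeomorphism_def)
  have "inj_on h {-a<..<a}"
    using homeomorphism_apply1[OF homeo] by (rule inj_on_inverseI)
  then consider "strict_mono_on {-a<..<a} h" | "strict_antimono_on {-a<..<a} h"
    using injective_eq_monotone_map[OF _ cont] by (auto simp: is_interval_convex_1)
  then show thesis
  proof cases
    case 1
    show thesis by (rule increasing_homeomorphism_extends[OF a 1 im]) (rule that)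
  next
    case 2
    have mono: "strict_mono_on {-a<..<a} (\<lambda>x. - h x)"
      using 2 by (auto simp: monotone_on_def)
    have im': "(\<lambda>x. - h x) ` {-a<..<a} = {-1<..<1}"
      unfolding image_image[of uminus h, symmetric] im by simp
    obtain g where g: "continuous_on {-a..a} g" "bij_betw g {-a..a} {-1..1}"
      "\<forall>x\<in>{-a<..<a}. g x = - h x" "\<forall>x\<in>{-a..a}. \<bar>g x\<bar> = 1 \<longleftrightarrow> \<bar>x\<bar> = a"
      by (rule increasing_homeomorphism_extends[OF a mono im'])
    show thesis
    proof (rule that[of "\<lambda>x. - g x"])
      have "bij_betw uminus {-1..1::real} {-1..1}"
        by (rule bij_betw_byWitness[of _ uminus]) auto
      from bij_betw_trans[OF g(2) this] show "bij_betw (\<lambda>x. - g x) {-a..a} {-1..1}"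
        by (simp add: o_def)
    qed (use g in \<open>auto intro: continuous_intros\<close>)
  qed
qed

lemma sphere_coords_in_S2: "\<bar>g x\<bar> \<le> 1 \<Longrightarrow> sphere_coords g (x, t) \<in> S2"
  by (simp add: sphere_coords_def norm_Pair norm_mult abs_square_le_1)

lemma sphere_coords_surj:
  assumes "bij_betw g {-a..a} {-1..1}" "q \<in> S2"
  obtains x t where "x \<in> {-a..a}" "t \<in> {-pi..pi}" "q = sphere_coords g (x, t)"
proof -
  obtain \<zeta> h where q: "q = (\<zeta>, h)" by force
  then have 1: "(cmod \<zeta>)\<^sup>2 + h\<^sup>2 = 1" using assms(2) by (simp add: norm_Pair)
  then have "h\<^sup>2 \<le> 1" using zero_le_power2[of "cmod \<zeta>"] by linarith
  then have "h \<in> {-1..1}" using abs_square_le_1[of h] by auto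
  then obtain x where x: "x \<in> {-a..a}" "h = g x"
    using assms(1) unfolding bij_betw_def by (metis imageE)
  have "cmod \<zeta> = sqrt (1 - h\<^sup>2)" using 1 by (intro real_sqrt_unique[symmetric]) auto
  then have "\<zeta> = of_real (sqrt (1 - (g x)\<^sup>2)) * exp (\<i> * of_real (Arg \<zeta>))"
    using x(2) rcis_cmod_Arg[of \<zeta>] by (simp add: rcis_def cis_conv_exp)
  moreover have "Arg \<zeta> \<in> {-pi..pi}" using Arg_bounded[of \<zeta>] by auto
  ultimately show thesis using that[OF x(1)] by (auto simp: q sphere_coords_def x(2))
qed

text \<open>The fibres of \<open>\<Phi>\<close> on the closed rectangle decide whether a sphere given by \<open>\<Phi>\<close> is embedded,
  whatever the height function \<open>h\<close> of the coordinates is.\<close>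

lemma inj_on_iff_fibres:
  fixes F :: "complex \<times> real \<Rightarrow> complex \<times> complex"
  assumes a: "a > 0" and homeo: "homeomorphism {-a<..<a} {-1<..<1} h k"
    and F: "continuous_on S2 F" and \<Phi>: "continuous_on ({-a..a} \<times> {-pi..pi}) \<Phi>"
    and eq: "\<And>x t. x \<in> {-a<..<a} \<Longrightarrow> t \<in> {-pi<..<pi} \<Longrightarrow> \<Phi> (x, t) = F (sphere_coords h (x, t))"
  shows "inj_on F S2 \<longleftrightarrow> (\<forall>x\<in>{-a..a}. \<forall>t\<in>{-pi..pi}. \<forall>x'\<in>{-a..a}. \<forall>t'\<in>{-pi..pi}.
    \<Phi> (x, t) = \<Phi> (x', t') \<longrightarrow> x = x' \<and> (\<bar>x\<bar> = a \<or> exp (\<i> * of_real t) = exp (\<i> * of_real t')))"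
    (is "_ \<longleftrightarrow> ?fibres")
proof -
  obtain g where g: "continuous_on {-a..a} g" "bij_betw g {-a..a} {-1..1}"
    "\<forall>x\<in>{-a<..<a}. g x = h x" "\<forall>x\<in>{-a..a}. \<bar>g x\<bar> = 1 \<longleftrightarrow> \<bar>x\<bar> = a"
    by (rule homeomorphism_interval_extends[OF a homeo])
  have g1: "\<bar>g x\<bar> \<le> 1" if "x \<in> {-a..a}" for x
    using bij_betw_apply[OF g(2) that] by auto
  have closure: "closure ({-a<..<a} \<times> {-pi<..<pi}) = {-a..a} \<times> {-pi..pi}"
    using a by (simp add: closure_Times closure_greaterThanLessThan)
  have cont: "continuous_on ({-a..a} \<times> {-pi..pi}) (sphere_coords g)"
  proof -
    have "continuous_on ({-a..a} \<times> {-pi..pi}) (\<lambda>p. g (fst p))"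
      by (rule continuous_on_compose2[OF g(1) continuous_on_fst[OF continuous_on_id]]) auto
    then show ?thesis
      unfolding sphere_coords_def case_prod_unfold by (intro continuous_intros)
  qed
  have "sphere_coords g ` ({-a..a} \<times> {-pi..pi}) \<subseteq> S2"
    using sphere_coords_in_S2[where g = g, OF g1] by blast
  then have "continuous_on ({-a..a} \<times> {-pi..pi}) (\<lambda>p. \<Phi> p - F (sphere_coords g p))"
    by (intro continuous_on_diff[OF \<Phi>] continuous_on_compose2[OF F cont])
  \<comment> \<open>The difference is continuous on the closed rectangle and will be seen to vanish
    on the open one, which is dense in it; so \<Phi> factors through \<open>F\<close> up to the
    boundary.\<close>
  note const = continuous_constant_on_closure[of "{-a<..<a} \<times> {-pi<..<pi}", unfolded closure, OF this]
  have \<Phi>F: "\<Phi> (x, t) = F (sphere_coords g (x, t))" if "x \<in> {-a..a}" "t \<in> {-pi..pi}" for x t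
  proof -
    have "\<Phi> p - F (sphere_coords g p) = 0" if "p \<in> {-a<..<a} \<times> {-pi<..<pi}" for p
      using that by (cases p) (simp add: eq g(3) sphere_coords_def)
    from const[OF this, of "(x, t)"] that show ?thesis by simp
  qed
  \<comment> \<open>At a pole the radius vanishes and the longitude is lost. Elsewhere it counts
    only modulo a full turn, since the closed rectangle contains both \<open>-pi\<close> and
    \<open>pi\<close>.\<close>
  have coords: "sphere_coords g (x, t) = sphere_coords g (x', t') \<longleftrightarrow>
      x = x' \<and> (\<bar>x\<bar> = a \<or> exp (\<i> * of_real t) = exp (\<i> * of_real t'))"
    if "x \<in> {-a..a}" "x' \<in> {-a..a}" for x x' t t'
  proof -
    have "g x = g x' \<longleftrightarrow> x = x'" by (rule inj_on_eq_iff[OF bij_betw_imp_inj_on[OF g(2)] that])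
    moreover have "1 - (g x)\<^sup>2 = 0 \<longleftrightarrow> \<bar>x\<bar> = a"
      unfolding bspec[OF g(4) that(1), symmetric] using abs_square_eq_1[of "g x"] by linarith
    then have "of_real (sqrt (1 - (g x)\<^sup>2)) * e = of_real (sqrt (1 - (g x)\<^sup>2)) * e' \<longleftrightarrow> \<bar>x\<bar> = a \<or> e = e'"
      for e e' :: complex
      unfolding mult_cancel_left of_real_eq_0_iff real_sqrt_eq_0_iff by blast
    ultimately show ?thesis
      by (cases "x = x'") (simp_all add: sphere_coords_def)
  qed
  show ?thesis
  proof
    assume inj: "inj_on F S2"
    show ?fibres
    proof (intro ballI impI)
      fix x t x' t' assume x: "x \<in> {-a..a}" "t \<in> {-pi..pi}" "x' \<in> {-a..a}" "t' \<in> {-pi..pi}"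
        and "\<Phi> (x, t) = \<Phi> (x', t')"
      then have "sphere_coords g (x, t) = sphere_coords g (x', t')"
        by (intro inj_onD[OF inj] sphere_coords_in_S2 g1) (auto simp: \<Phi>F)
      then show "x = x' \<and> (\<bar>x\<bar> = a \<or> exp (\<i> * of_real t) = exp (\<i> * of_real t'))"
        unfolding coords[OF x(1,3)] .
    qed
  next
    assume fib: ?fibres
    show "inj_on F S2"
    proof (rule inj_onI)
      fix p q assume "p \<in> S2" "q \<in> S2" and Fpq: "F p = F q"
      obtain x t where 1: "x \<in> {-a..a}" "t \<in> {-pi..pi}" "p = sphere_coords g (x, t)"
        using sphere_coords_surj[OF g(2) \<open>p \<in> S2\<close>] by blast
      obtain x' t' where 2: "x' \<in> {-a..a}" "t' \<in> {-pi..pi}" "q = sphere_coords g (x', t')"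
        using sphere_coords_surj[OF g(2) \<open>q \<in> S2\<close>] by blast
      have "\<Phi> (x, t) = \<Phi> (x', t')"
        using Fpq 1 2 by (simp add: \<Phi>F)
      then show "p = q"
        unfolding 1(3) 2(3) coords[OF 1(1) 2(1)] using fib 1(1,2) 2(1,2) by blast
    qed
  qed
qed

text \<open>The sphere is compact, so a continuous injection of it is a homeomorphism onto its
  image.\<close>

lemma sphere_embedding_iff_inj_on:
  assumes "sphere_immersion F"
  shows "sphere_embedding F \<longleftrightarrow> inj_on F S2"
proof -
  have "continuous_on S2 F"
    using assms unfolding sphere_immersion_def smooth_on_S2_def smooth_on_open_def
    by (metis Ck_on.simps(1) continuous_on_subset)
  then have "\<exists>G. homeomorphism S2 (F ` S2) F G" if "inj_on F S2"
    using homeomorphism_compact[OF compact_sphere _ refl that] by blast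
  moreover have "inj_on F S2" if "homeomorphism S2 (F ` S2) F G" for G
    using homeomorphism_apply1[OF that] by (rule inj_on_inverseI)
  ultimately show ?thesis
    unfolding sphere_embedding_def using assms by blast
qed

section \<open>Levi-Civita connection and traces\<close>

text \<open>The Hopf field is real linear and skew for the Euclidean product. Hence two of the six
  terms from the metric derivatives cancel and the other four are equal in pairs.\<close>

lemma levi_civita_eq:
  "levi_civita \<kappa> \<tau> p X Y Y' Z =
     4 / \<kappa> * (Y' \<bullet> Z + (4 * \<tau>\<^sup>2 / \<kappa> - 1) * ((Y' \<bullet> hopf_field p) * (Z \<bullet> hopf_field p)
       + (Y \<bullet> hopf_field p) * (Z \<bullet> hopf_field X) + (X \<bullet> hopf_field p) * (Z \<bullet> hopf_field Y)))"
proof -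
  have c: "\<And>c. ((\<lambda>q. c) has_derivative (\<lambda>h. 0)) (at p)" by simp
  have skew: "a \<bullet> hopf_field b = - (b \<bullet> hopf_field a)" for a b
    by (simp add: hopf_field_def inner_prod_def inner_complex_def algebra_simps)
  have dif: "dif (\<lambda>q. berger_metric \<kappa> \<tau> q a b) p w = 4 / \<kappa> * ((4 * \<tau>\<^sup>2 / \<kappa> - 1) *
     ((a \<bullet> hopf_field p) * (b \<bullet> hopf_field w) + (a \<bullet> hopf_field w) * (b \<bullet> hopf_field p)))" for a b w
    unfolding berger_metric_field_derivative[OF c c, THEN frechet_derivative_at, symmetric] by simp
  define a b c where "a = Y \<bullet> hopf_field X" and "b = Z \<bullet> hopf_field X" and "c = Z \<bullet> hopf_field Y"
  moreover have "X \<bullet> hopf_field Y = - a" "X \<bullet> hopf_field Z = - b" "Y \<bullet> hopf_field Z = - c"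
    unfolding a_def b_def c_def by (rule skew)+
  ultimately show ?thesis
    unfolding levi_civita_def dif unfolding berger_metric_def
    by (simp add: algebra_simps add_divide_distrib diff_divide_distrib)
qed

text \<open>The expression in \<open>zero\<close> is multiplied by the squared determinant under a change of basis, so no
  nondegeneracy of \<open>e\<close>, \<open>f\<close> is needed.\<close>

lemma trace_form_eq_0:
  fixes B G :: "'a::real_vector \<Rightarrow> 'a \<Rightarrow> real"
  assumes B: "bilinear B" and G: "bilinear G"
    and uv: "u = u1 *\<^sub>R e + u2 *\<^sub>R f" "v = v1 *\<^sub>R e + v2 *\<^sub>R f"
    and sym: "\<And>x y. G x y = G y x"
    and orth: "G u u = 1" "G v v = 1" "G u v = 0"
    and zero: "B e e * G f f - (B e f + B f e) * G e f + B f f * G e e = 0"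
  shows "B u u + B v v = 0"
proof -
  note exp = bilinear_ladd bilinear_radd bilinear_lmul bilinear_rmul
  have "B u u * G v v - (B u v + B v u) * G u v + B v v * G u u
      = (u1 * v2 - u2 * v1)\<^sup>2 * (B e e * G f f - (B e f + B f e) * G e f + B f f * G e e)"
    unfolding uv exp[OF B] exp[OF G] sym[of f e] real_scaleR_def
    by algebra
  then show ?thesis
    by (simp add: orth zero)
qed

lemma has_derivative_compose_snd:
  "(g has_derivative g') (at (snd q)) \<Longrightarrow> ((\<lambda>p. g (snd p)) has_derivative (\<lambda>v. g' (snd v))) (at q)"
  by (rule has_derivative_compose[OF bounded_linear_imp_has_derivative[OF bounded_linear_snd]])

text \<open>The immersion and its normal are both rotation equivariant maps of this form, so one
  computation serves both.\<close>

lemma has_derivative_rotational: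
  fixes z w :: "real \<Rightarrow> complex"
  assumes "(z has_vector_derivative z') (at (snd q))" "(w has_vector_derivative w') (at (snd q))"
  shows "((\<lambda>p. (z (snd p), w (snd p) * fst p)) has_derivative
     (\<lambda>u. (snd u *\<^sub>R z', w (snd q) * fst u + snd u *\<^sub>R (w' * fst q)))) (at q)"
proof -
  note z = has_derivative_compose_snd[OF assms(1)[unfolded has_vector_derivative_def]]
  note w = has_derivative_compose_snd[OF assms(2)[unfolded has_vector_derivative_def]]
  show ?thesis
    by (auto intro!: derivative_eq_intros z w)
qed

lemma inner_mult_right_complex: "(a * e) \<bullet> (b * e) = (cmod e)\<^sup>2 * (a \<bullet> b)" for a b e :: complex
  by (simp add: inner_complex_def cmod_power2) algebra

section \<open>The immersed sphere\<close>

locale cmc_sphere =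
  fixes \<kappa> \<tau> H :: real
  assumes kappa: "\<kappa> > 0" and tau: "\<tau> \<noteq> 0" and H: "H > 0" and kappa_neq: "\<kappa> \<noteq> 4 * \<tau>\<^sup>2"
begin

definition d :: real where "d = 4 * \<tau>\<^sup>2 - \<kappa>"
definition P :: real where "P = H\<^sup>2 + \<tau>\<^sup>2"
text \<open>The squared length of \<open>(2 (H + i \<tau> h), sqrt \<kappa> \<zeta>)\<close> for a
  point \<open>(\<zeta>, h)\<close> of the sphere; \<open>s\<close> rescales this vector to unit
  length.\<close>

definition D :: "real \<Rightarrow> real" where "D h = 4 * H\<^sup>2 + \<kappa> + d * h\<^sup>2"
definition s :: "real \<Rightarrow> real" where "s h = 1 / sqrt (D h)"
text \<open>The second summand of y as a function of \<lambda>: the primitive of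
  \<open>(H / \<tau>) d / D\<close> that vanishes at 0, in the form that the sign of
  \<open>d\<close> requires.\<close>

definition \<beta> :: "real \<Rightarrow> real" where
  "\<beta> h = (if d > 0 then H / \<tau> * (sqrt d / sqrt (4 * H\<^sup>2 + \<kappa>)) * arctan (sqrt d / sqrt (4 * H\<^sup>2 + \<kappa>) * h)
     else - (H / \<tau> * (sqrt (- d) / sqrt (4 * H\<^sup>2 + \<kappa>)) * artanh (sqrt (- d) / sqrt (4 * H\<^sup>2 + \<kappa>) * h)))"
definition E :: "real \<Rightarrow> complex" where "E h = of_real (s h) * exp (- (\<i> * of_real (\<beta> h)))"

definition z :: "real \<Rightarrow> complex" where "z h = 2 * Complex H (\<tau> * h) * E h"
definition w :: "real \<Rightarrow> complex" where "w h = of_real (sqrt \<kappa> * s h)"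
text \<open>The normal \<open>N\<close> below is found as follows. The vector
  \<open>n = ((4 \<tau>\<^sup>2 h\<^sup>2 + \<kappa> (1 - h\<^sup>2) - 4 i \<tau> H h) E, - 2 \<surd>\<kappa> H s \<zeta>)\<close> is tangent to the three-sphere and
  orthogonal to the surface for the round metric. With \<open>V\<close> the Hopf field, the combination
  \<open>n + (d h / (2 \<tau>)) V\<close> is orthogonal to it for the Berger metric and has constant length \<open>2\<close>.\<close>

definition nz :: "real \<Rightarrow> complex" where "nz h = of_real (\<kappa> / (2 * \<tau>)) * Complex \<tau> (- H * h) * E h"
definition nw :: "real \<Rightarrow> complex" where
  "nw h = of_real (sqrt \<kappa> / (4 * \<tau>)) * Complex (- 4 * \<tau> * H) (d * h) * of_real (s h)"

definition F :: "complex \<times> real \<Rightarrow> complex \<times> complex" where "F q = (z (snd q), w (snd q) * fst q)"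
definition N :: "complex \<times> real \<Rightarrow> complex \<times> complex" where "N q = (nz (snd q), nw (snd q) * fst q)"

text \<open>A neighbourhood of the sphere on which \<open>s\<close> and \<open>E\<close> are smooth;
  for negative \<open>d\<close> it excludes large heights.\<close>

definition U :: "(complex \<times> real) set" where "U = {q. D (snd q) > 0}"

lemma P_pos: "P > 0"
  using H by (simp add: P_def add_pos_nonneg)

lemma d_neq_0: "d \<noteq> 0"
  using kappa_neq by (simp add: d_def)

lemma D_alt: "D h = 4 * P - d * (1 - h\<^sup>2)"
  by (simp add: D_def P_def d_def algebra_simps)

text \<open>Regrouped, \<open>D h\<close> is the positive \<open>4 H^2\<close> plus terms that are
  nonnegative for heights on the sphere, whatever the sign of \<open>d\<close>.\<close>

lemma D_pos: "D h > 0" if "\<bar>h\<bar> \<le> 1"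
proof -
  have h: "h\<^sup>2 \<le> 1" using that by (simp add: abs_square_le_1)
  have "D h = 4 * H\<^sup>2 + \<kappa> * (1 - h\<^sup>2) + 4 * \<tau>\<^sup>2 * h\<^sup>2"
    by (simp add: D_def d_def algebra_simps)
  also have "\<dots> > 0"
    using H kappa h by (intro add_pos_nonneg) auto
  finally show ?thesis .
qed

lemma s_pos: "D h > 0 \<Longrightarrow> s h > 0"
  by (simp add: s_def)

lemma s_sq: "D h > 0 \<Longrightarrow> (s h)\<^sup>2 = 1 / D h"
  by (simp add: s_def power_divide)

section \<open>Derivatives of the profile functions\<close>

lemma s_deriv: "(s has_real_derivative - (d * h * s h ^ 3)) (at h)" if "D h > 0"
proof -
  have D: "(D has_real_derivative 2 * d * h) (at h)"
    unfolding D_def by (auto intro!: derivative_eq_intros)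
  show ?thesis
    unfolding s_def[abs_def] using that
    by (auto intro!: derivative_eq_intros D simp: field_simps power3_eq_cube)
qed

text \<open>With \<open>c^2 = |d| / R\<close> one has \<open>D h = R (1 + (c h)^2)\<close> or
  \<open>D h = R (1 - (c h)^2)\<close> according to the sign of \<open>d\<close>, so both branches
  integrate \<open>d / D\<close>.\<close>

lemma \<beta>_deriv: "(\<beta> has_real_derivative H / \<tau> * d / D h) (at h)" if h: "D h > 0"
proof -
  define R where "R = 4 * H\<^sup>2 + \<kappa>"
  have R: "R > 0" using kappa by (simp add: R_def add_nonneg_pos)
  have DR: "D h = R + d * h\<^sup>2" by (simp add: D_def R_def)
  define c where "c = sqrt \<bar>d\<bar> / sqrt R"
  have c2: "c\<^sup>2 = \<bar>d\<bar> / R" using R by (simp add: c_def power_divide)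
  show ?thesis
  proof (cases "d > 0")
    case True
    then have eq: "\<beta> = (\<lambda>h. H / \<tau> * c * arctan (c * h))"
      by (simp add: \<beta>_def fun_eq_iff c_def R_def)
    have eq': "1 / (1 + (c * h)\<^sup>2) * c * c = d / D h"
      using True R h by (simp add: DR field_simps power_mult_distrib c2 flip: power2_eq_square)
    have "(\<beta> has_real_derivative H / \<tau> * (1 / (1 + (c * h)\<^sup>2) * c * c)) (at h)"
      unfolding eq by (auto intro!: derivative_eq_intros simp: tau divide_inverse mult_ac)
    then show ?thesis unfolding eq' by simp
  next
    case False
    then have eq: "\<beta> = (\<lambda>h. - (H / \<tau> * c * artanh (c * h)))"
      by (simp add: \<beta>_def fun_eq_iff c_def R_def)
    \<comment> \<open>In this case positivity of \<open>D h\<close> is what puts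
      \<open>c * h\<close> into the domain of \<open>artanh\<close>.\<close>
    have "(c * h)\<^sup>2 < 1" using False R h by (simp add: DR power_mult_distrib c2 field_simps)
    then have ch: "\<bar>c * h\<bar> < 1" by (simp add: abs_square_less_1)
    have eq': "1 / (1 - (c * h)\<^sup>2) * c * c = - d / D h"
      using False R h by (simp add: DR field_simps power_mult_distrib c2 flip: power2_eq_square)
    have "((\<lambda>h. artanh (c * h)) has_real_derivative 1 / (1 - (c * h)\<^sup>2) * c) (at h)"
      by (rule DERIV_chain2[where f = artanh and g = "\<lambda>h. c * h", OF artanh_real_has_field_derivative])
        (use ch in \<open>auto intro!: derivative_eq_intros\<close>)
    from DERIV_minus[OF DERIV_cmult[OF this]]
    have "(\<beta> has_real_derivative - (H / \<tau> * (1 / (1 - (c * h)\<^sup>2) * c * c))) (at h)"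
      unfolding eq by (rule DERIV_cong) simp
    then show ?thesis unfolding eq' by simp
  qed
qed

text \<open>The derivatives of \<open>s\<close> and \<open>E\<close> are polynomials in \<open>h\<close>, \<open>s\<close> and \<open>E\<close>; smoothness follows by induction
  on the order.\<close>

lemma E_deriv:
  assumes "D h > 0"
  shows "(E has_vector_derivative - (of_real (d * (s h)\<^sup>2) * Complex h (H / \<tau>) * E h)) (at h)"
proof -
  have e: "((\<lambda>h. exp (- (\<i> * of_real (\<beta> h)))) has_vector_derivative
     - (\<i> * of_real (H / \<tau> * d * (s h)\<^sup>2)) * exp (- (\<i> * of_real (\<beta> h)))) (at h)"
    by (rule has_vector_derivative_eq_rhs, rule field_vector_diff_chain_at[OF _ DERIV_exp, unfolded o_def])
     (auto intro!: derivative_eq_intros has_vector_derivative_real_field \<beta>_deriv[OF assms]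
        simp: s_sq[OF assms])
  have s: "((\<lambda>h. of_real (s h)) has_vector_derivative complex_of_real (- (d * h * s h ^ 3))) (at h)"
    using s_deriv[OF assms] by (rule has_vector_derivative_of_real)
  show ?thesis
    unfolding E_def[abs_def]
    by (rule has_vector_derivative_eq_rhs[OF has_vector_derivative_mult[OF s e]])
      (simp add: complex_eq_iff power3_eq_cube power2_eq_square field_simps)
qed

lemma open_U: "open U"
proof -
  have "continuous_on UNIV (\<lambda>q::complex \<times> real. D (snd q))"
    unfolding D_def by (intro continuous_intros)
  then show ?thesis
    unfolding U_def by (intro open_Collect_less) (auto intro: continuous_intros)
qed

lemma S2_iff: "(\<zeta>, h) \<in> S2 \<longleftrightarrow> (cmod \<zeta>)\<^sup>2 + h\<^sup>2 = 1"
  by (simp add: norm_Pair)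

lemma S2_height: "(\<zeta>, h) \<in> S2 \<Longrightarrow> \<bar>h\<bar> \<le> 1"
  unfolding S2_iff using zero_le_power2[of "cmod \<zeta>"] abs_square_le_1[of h] by linarith

lemma S2_subset_U: "S2 \<subseteq> U"
  unfolding U_def using S2_height D_pos by auto

lemma E_norm: "D h > 0 \<Longrightarrow> cmod (E h) = s h"
  using s_pos[of h] by (simp add: E_def norm_mult)

lemma E_nz: "D h > 0 \<Longrightarrow> E h \<noteq> 0"
  using s_pos[of h] by (simp add: E_def)

text \<open>The product \<open>(H + i \<tau> h) (h + i H / \<tau>)\<close> is purely imaginary, and
  \<open>\<tau>^2 D - d (H^2 + \<tau>^2 h^2) = \<kappa> P\<close>. So the derivative is a nonzero
  real multiple of \<open>i E\<close>, also at the equator.\<close>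

lemma z_deriv:
  assumes "D h > 0"
  shows "(z has_vector_derivative of_real (2 * \<kappa> * P / \<tau> * (s h)\<^sup>2) * \<i> * E h) (at h)"
proof -
  have l: "((\<lambda>h. 2 * Complex H (\<tau> * h)) has_vector_derivative 2 * Complex 0 \<tau>) (at h)"
    unfolding Complex_eq by (auto intro!: derivative_eq_intros)
  have D0: "D h \<noteq> 0" using assms by simp
  have c: "2 * Complex 0 \<tau> - 2 * Complex H (\<tau> * h) * (of_real (d * (s h)\<^sup>2) * Complex h (H / \<tau>))
      = of_real (2 * \<kappa> * P / \<tau> * (s h)\<^sup>2) * \<i>"
    unfolding s_sq[OF assms] complex_eq_iff using tau D0
    by (simp add: field_simps) (simp add: D_def P_def d_def algebra_simps power2_eq_square)
  show ?thesis
    unfolding z_def[abs_def]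
    by (rule has_vector_derivative_eq_rhs[OF has_vector_derivative_mult[OF l E_deriv[OF assms]]])
      (subst c[symmetric], simp only: algebra_simps mult_minus_left mult_minus_right add.right_inverse add_0_right add_0_left)
qed

lemma nz_deriv:
  assumes "D h > 0"
  shows "(nz has_vector_derivative of_real (- \<kappa> / (2 * \<tau>) * P * (s h)\<^sup>2) * Complex (d * h / \<tau>) (4 * H) * E h) (at h)"
proof -
  have l: "((\<lambda>h. of_real (\<kappa> / (2 * \<tau>)) * Complex \<tau> (- H * h)) has_vector_derivative
      of_real (\<kappa> / (2 * \<tau>)) * Complex 0 (- H)) (at h)"
    unfolding Complex_eq by (auto intro!: derivative_eq_intros)
  have D0: "D h \<noteq> 0" using assms by simp
  have c: "of_real (\<kappa> / (2 * \<tau>)) * Complex 0 (- H)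
      - of_real (\<kappa> / (2 * \<tau>)) * Complex \<tau> (- H * h) * (of_real (d * (s h)\<^sup>2) * Complex h (H / \<tau>))
      = of_real (- \<kappa> / (2 * \<tau>) * P * (s h)\<^sup>2) * Complex (d * h / \<tau>) (4 * H)"
    unfolding s_sq[OF assms] complex_eq_iff using tau D0
    by (simp add: field_simps) (simp add: D_def P_def d_def algebra_simps power2_eq_square)
  show ?thesis
    unfolding nz_def[abs_def]
    by (rule has_vector_derivative_eq_rhs[OF has_vector_derivative_mult[OF l E_deriv[OF assms]]])
      (subst c[symmetric], simp only: algebra_simps mult_minus_left mult_minus_right add.right_inverse add_0_right add_0_left)
qed

lemma w_deriv:
  assumes "D h > 0"
  shows "(w has_vector_derivative of_real (- sqrt \<kappa> * d * h * s h ^ 3)) (at h)"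
  unfolding w_def[abs_def]
  by (intro has_vector_derivative_of_real DERIV_cong[OF DERIV_cmult[OF s_deriv[OF assms]]]) simp

lemma nw_deriv:
  assumes "D h > 0"
  shows "(nw has_vector_derivative of_real (sqrt \<kappa> / (4 * \<tau>)) *
    (\<i> * of_real (d * s h) - Complex (- 4 * \<tau> * H) (d * h) * of_real (d * h * s h ^ 3))) (at h)"
proof -
  have l: "((\<lambda>h. of_real (sqrt \<kappa> / (4 * \<tau>)) * Complex (- 4 * \<tau> * H) (d * h)) has_vector_derivative
      of_real (sqrt \<kappa> / (4 * \<tau>)) * Complex 0 d) (at h)"
    unfolding Complex_eq by (auto intro!: derivative_eq_intros)
  show ?thesis
    unfolding nw_def[abs_def]
    by (rule has_vector_derivative_eq_rhs[OF has_vector_derivative_mult[OF l has_vector_derivative_of_real[OF s_deriv[OF assms]]]])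
      (simp add: complex_eq_iff algebra_simps)
qed

lemma dif_F:
  assumes "D h > 0"
  shows "dif F (\<zeta>, h) (v, k) = (of_real (2 * \<kappa> * P / \<tau> * (s h)\<^sup>2 * k) * \<i> * E h,
    of_real (sqrt \<kappa>) * (of_real (s h) * v - of_real (d * h * s h ^ 3 * k) * \<zeta>))"
proof -
  have "(F has_derivative (\<lambda>u. (snd u *\<^sub>R (of_real (2 * \<kappa> * P / \<tau> * (s h)\<^sup>2) * \<i> * E h),
      w h * fst u + snd u *\<^sub>R (of_real (- sqrt \<kappa> * d * h * s h ^ 3) * \<zeta>)))) (at (\<zeta>, h))"
    unfolding F_def[abs_def]
    by (rule has_derivative_rotational[where z = z and w = w and q = "(\<zeta>, h)", unfolded fst_conv snd_conv,
          OF z_deriv w_deriv, OF assms assms])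
  from frechet_derivative_at[OF this, symmetric] show ?thesis
    by (simp add: w_def scaleR_conv_of_real algebra_simps)
qed

lemma dif_N:
  assumes "D h > 0"
  shows "dif N (\<zeta>, h) (v, k) =
   (of_real (- \<kappa> / (2 * \<tau>) * P * (s h)\<^sup>2 * k) * Complex (d * h / \<tau>) (4 * H) * E h,
    of_real (sqrt \<kappa> / (4 * \<tau>)) * (Complex (- 4 * \<tau> * H) (d * h) * of_real (s h) * v +
      of_real k * (\<i> * of_real (d * s h) - Complex (- 4 * \<tau> * H) (d * h) * of_real (d * h * s h ^ 3)) * \<zeta>))"
proof -
  have "(N has_derivative (\<lambda>u. (snd u *\<^sub>R (of_real (- \<kappa> / (2 * \<tau>) * P * (s h)\<^sup>2) * Complex (d * h / \<tau>) (4 * H) * E h),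
      nw h * fst u + snd u *\<^sub>R (of_real (sqrt \<kappa> / (4 * \<tau>)) *
    (\<i> * of_real (d * s h) - Complex (- 4 * \<tau> * H) (d * h) * of_real (d * h * s h ^ 3)) * \<zeta>)))) (at (\<zeta>, h))"
    unfolding N_def[abs_def]
    by (rule has_derivative_rotational[where z = nz and w = nw and q = "(\<zeta>, h)", unfolded fst_conv snd_conv,
          OF nz_deriv nw_deriv, OF assms assms])
  from frechet_derivative_at[OF this, symmetric] show ?thesis
    by (simp add: nw_def scaleR_conv_of_real algebra_simps)
qed

section \<open>Smoothness and regularity of the immersion\<close>

lemma Ck_on_snd: "Ck_on k U snd"
  by (intro Ck_on_linear open_U bounded_linear_snd)

lemma Ck_on_height: "Ck_on k U (\<lambda>q. complex_of_real (snd q))"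
  by (intro Ck_on_linear open_U bounded_linear_compose[OF bounded_linear_of_real bounded_linear_snd])

lemma Ck_on_s: "Ck_on k U (\<lambda>q. s (snd q))"
proof (induction k)
  case 0
  have "continuous_on {h. D h > 0} s"
    by (rule continuous_at_imp_continuous_on) (blast dest: DERIV_isCont[OF s_deriv])
  then show ?case
    unfolding Ck_on.simps by (rule continuous_on_compose2[OF _ continuous_on_snd[OF continuous_on_id]]) (auto simp: U_def)
next
  case (Suc k)
  show ?case
  proof (rule Ck_on_SucI[OF open_U])
    show "((\<lambda>q. s (snd q)) has_derivative (\<lambda>v. snd v * (- d * snd q * s (snd q) ^ 3))) (at q)"
      if "q \<in> U" for q
      using has_derivative_compose_snd[OF s_deriv[of "snd q", unfolded has_field_derivative_def]] that
      by (simp add: U_def mult_ac)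
    show "Ck_on k U (\<lambda>q. snd v * (- d * snd q * s (snd q) ^ 3))" for v :: "complex \<times> real"
      by (rule Ck_on_intros open_U Ck_on_snd Suc)+
  qed
qed

lemma Ck_on_of_real_s: "Ck_on k U (\<lambda>q. complex_of_real (s (snd q)))"
  by (rule Ck_on_linear_compose[OF bounded_linear_of_real open_U Ck_on_s])

lemma Ck_on_E: "Ck_on k U (\<lambda>q. E (snd q))"
proof (induction k)
  case 0
  have "continuous_on {h. D h > 0} E"
    by (rule continuous_at_imp_continuous_on) (blast dest: has_vector_derivative_continuous[OF E_deriv])
  then show ?case
    unfolding Ck_on.simps by (rule continuous_on_compose2[OF _ continuous_on_snd[OF continuous_on_id]]) (auto simp: U_def)
next
  case (Suc k)
  show ?case
  proof (rule Ck_on_SucI[OF open_U])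
    show "((\<lambda>q. E (snd q)) has_derivative (\<lambda>v. snd v *\<^sub>R (- of_real d * (of_real (s (snd q)))\<^sup>2 *
       (of_real (snd q) + \<i> * of_real (H / \<tau>)) * E (snd q)))) (at q)"
      if "q \<in> U" for q
      using has_derivative_compose_snd[OF E_deriv[of "snd q", unfolded has_vector_derivative_def]] that
      by (simp add: U_def Complex_eq)
    show "Ck_on k U (\<lambda>q. snd v *\<^sub>R (- of_real d * (of_real (s (snd q)))\<^sup>2 *
       (of_real (snd q) + \<i> * of_real (H / \<tau>)) * E (snd q)))" for v :: "complex \<times> real"
      by (rule Ck_on_intros open_U Ck_on_of_real_s Ck_on_height Suc)+
  qed
qed

lemma Ck_on_fst: "Ck_on k U fst"
  by (intro Ck_on_linear open_U bounded_linear_fst)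

lemma smooth_F: "smooth_on_S2 F"
  unfolding smooth_on_S2_def smooth_on_open_def
proof (intro exI[of _ U] conjI allI S2_subset_U open_U)
  show "Ck_on k U F" for k
    unfolding F_def[abs_def] z_def w_def Complex_eq of_real_mult
    by (rule Ck_on_intros open_U Ck_on_of_real_s Ck_on_height Ck_on_E Ck_on_fst)+
qed

lemma smooth_N: "smooth_on_S2 N"
  unfolding smooth_on_S2_def smooth_on_open_def
proof (intro exI[of _ U] conjI allI S2_subset_U open_U)
  show "Ck_on k U N" for k
    unfolding N_def[abs_def] nz_def nw_def Complex_eq of_real_mult
    by (rule Ck_on_intros open_U Ck_on_of_real_s Ck_on_height Ck_on_E Ck_on_fst)+
qed

lemma norm_z_sq: "D h > 0 \<Longrightarrow> (cmod (z h))\<^sup>2 = 4 * (H\<^sup>2 + \<tau>\<^sup>2 * h\<^sup>2) / D h"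
  by (simp add: z_def norm_mult E_norm power_mult_distrib s_sq cmod_power2)

lemma norm_w_sq: "D h > 0 \<Longrightarrow> (cmod (w h))\<^sup>2 = \<kappa> / D h"
  using kappa by (simp add: w_def norm_mult power_mult_distrib s_sq)

lemma F_in_S3: "F ` S2 \<subseteq> S3"
proof safe
  fix \<zeta> h p q assume q: "(\<zeta>, h) \<in> S2" and F: "(p, q) = F (\<zeta>, h)"
  have D: "D h > 0" using D_pos[OF S2_height[OF q]] .
  have \<zeta>: "(cmod \<zeta>)\<^sup>2 = 1 - h\<^sup>2" using q[unfolded S2_iff] by simp
  have "(cmod (z h))\<^sup>2 + (cmod (w h * \<zeta>))\<^sup>2 = 1"
    using D unfolding norm_mult power_mult_distrib norm_z_sq[OF D] norm_w_sq[OF D] \<zeta>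
    by (simp add: field_simps) (simp add: D_def d_def algebra_simps)
  then show "(cmod p)\<^sup>2 + (cmod q)\<^sup>2 = 1"
    using F by (simp add: F_def)
qed

text \<open>The first component of \<open>dif F q (v, k)\<close> recovers \<open>k\<close>, because
  \<open>E\<close> and the factor in front of \<open>k\<close> do not vanish; the second then
  recovers \<open>v\<close>, because \<open>s\<close> does not vanish.\<close>

lemma immersion_F: "sphere_immersion F"
  unfolding sphere_immersion_def
proof (intro conjI smooth_F F_in_S3 ballI inj_onI)
  fix q x y assume q: "q \<in> S2" and eq: "dif F q x = dif F q y"
  obtain \<zeta> h where qq: "q = (\<zeta>, h)" by force
  have D: "D h > 0" using D_pos[OF S2_height] q qq by simp
  obtain v k v' k' where xy: "x = (v, k)" "y = (v', k')" by force
  have "s h \<noteq> 0" using s_pos[OF D] by simp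
  then have "k = k'" "v = v'"
    using eq E_nz[OF D] P_pos kappa tau by (auto simp: qq xy dif_F[OF D])
  then show "x = y" by (simp add: xy)
qed

subsection \<open>Mean curvature\<close>

text \<open>Coordinates in the complex frame \<open>(E h, 0)\<close>,
  \<open>(0, s h \<zeta>)\<close>. The phase drops out of inner products and
  \<open>s^2 = 1 / D\<close>, so these become rational in \<open>h\<close>.\<close>

definition vec :: "complex \<Rightarrow> real \<Rightarrow> complex \<Rightarrow> complex \<Rightarrow> complex \<times> complex" where
  "vec \<zeta> h a b = (a * E h, b * (of_real (s h) * \<zeta>))"

lemma inner_vec:
  assumes "(\<zeta>, h) \<in> S2"
  shows "vec \<zeta> h a b \<bullet> vec \<zeta> h a' b' = (a \<bullet> a' + (1 - h\<^sup>2) * (b \<bullet> b')) / D h"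
proof -
  have D: "D h > 0" using D_pos[OF S2_height[OF assms]] .
  have "(cmod \<zeta>)\<^sup>2 = 1 - h\<^sup>2" using assms[unfolded S2_iff] by simp
  then show ?thesis
    by (simp add: vec_def inner_prod_def inner_mult_right_complex E_norm[OF D] norm_mult
        power_mult_distrib s_sq[OF D] add_divide_distrib)
qed

lemma hopf_vec: "hopf_field (vec \<zeta> h a b) = vec \<zeta> h (\<i> * a) (\<i> * b)"
  by (simp add: vec_def hopf_field_def)

lemma F_vec: "F (\<zeta>, h) = vec \<zeta> h (2 * Complex H (\<tau> * h)) (of_real (sqrt \<kappa>))"
  by (simp add: F_def vec_def z_def w_def)

lemma N_vec: "N (\<zeta>, h) = vec \<zeta> h (of_real (\<kappa> / (2 * \<tau>)) * Complex \<tau> (- H * h))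
   (of_real (sqrt \<kappa> / (4 * \<tau>)) * Complex (- 4 * \<tau> * H) (d * h))"
  by (simp add: N_def vec_def nz_def nw_def)

lemma kappa_sqrt: "sqrt \<kappa> * sqrt \<kappa> = \<kappa>" "sqrt \<kappa> * (sqrt \<kappa> * x) = \<kappa> * x"
  using kappa by (simp_all flip: mult.assoc)

lemma epsilon_eq: "4 * \<tau>\<^sup>2 / \<kappa> - 1 = d / \<kappa>"
  using kappa by (simp add: d_def field_simps)

lemma unit_normal_N: "unit_normal \<kappa> \<tau> F N"
  unfolding unit_normal_def
proof (intro conjI smooth_N ballI)
  fix q assume q: "q \<in> S2"
  obtain \<zeta> h where qq: "q = (\<zeta>, h)" by force
  note q = q[unfolded qq]
  have D: "D h > 0" using D_pos[OF S2_height[OF q]] .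
  have D0: "D h \<noteq> 0" "\<kappa> \<noteq> 0" using D kappa by auto
  note v = N_vec F_vec hopf_vec inner_vec[OF q]
  have NV: "N q \<bullet> hopf_field (F q) = - \<kappa> * h / (4 * \<tau>)"
    unfolding qq v using tau D0
    by (simp add: inner_complex_def field_simps kappa_sqrt)
      (simp add: D_def d_def algebra_simps power2_eq_square kappa_sqrt)
  show "N q \<in> tangent_space (F q)"
    unfolding tangent_space_def mem_Collect_eq qq v using tau kappa
    by (simp add: inner_complex_def field_simps kappa_sqrt power2_eq_square)
  show "berger_metric \<kappa> \<tau> (F q) (N q) (N q) = 1"
    unfolding berger_metric_def epsilon_eq NV
    unfolding qq v using tau D0 kappa
    by (simp add: inner_complex_def field_simps kappa_sqrt)
      (simp add: D_def d_def algebra_simps power2_eq_square kappa_sqrt)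
  fix u assume u: "u \<in> tangent_space q"
  obtain v k where uu: "u = (v, k)" by force
  \<comment> \<open>Tangency fixes the radial part of \<open>v\<close> in terms of \<open>k\<close>;
    \<open>r\<close> is the free part along the parallel. As nothing is divided by the norm of
    \<zeta>, the poles are covered too.\<close>
  have p: "\<zeta> \<bullet> v = - h * k" using u by (simp add: uu qq tangent_space_def)
  define r where "r = (\<i> * \<zeta>) \<bullet> v"
  define c where "c = 2 * \<kappa> * P / \<tau> * (s h)\<^sup>2 * k"
  define g where "g = d * h * (s h)\<^sup>2 * k"
  have X: "dif F q u = (of_real c * \<i> * E h, of_real (sqrt \<kappa>) * of_real (s h) * (v - of_real g * \<zeta>))"
    by (simp add: qq uu dif_F[OF D] c_def g_def algebra_simps power2_eq_square power3_eq_cube)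
  have m: "\<zeta> \<bullet> \<zeta> = 1 - h\<^sup>2" using q[unfolded S2_iff] by (simp add: dot_square_norm)
  have in2: "(b * (of_real (s h) * \<zeta>)) \<bullet> (of_real (sqrt \<kappa>) * of_real (s h) * (v - of_real g * \<zeta>))
     = (s h)\<^sup>2 * (sqrt \<kappa> * (Re b * (\<zeta> \<bullet> v - g * (\<zeta> \<bullet> \<zeta>)) + Im b * r))" for b
    by (simp add: r_def inner_complex_def) algebra
  have inX: "vec \<zeta> h a b \<bullet> dif F q u = (Im a * c + sqrt \<kappa> * (Re b * (- h * k - g * (1 - h\<^sup>2)) + Im b * r)) / D h" for a b
    using inner_mult_right_complex[of a "E h" "of_real c * \<i>"]
    unfolding X vec_def inner_prod_def fst_conv snd_conv in2 m p E_norm[OF D] s_sq[OF D]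
    by (simp add: inner_complex_def add_divide_distrib)
  have VX: "dif F q u \<bullet> hopf_field (F q) = (2 * H * c + \<kappa> * r) / D h"
    unfolding inner_commute[of "dif F q u"] using inX[of "\<i> * (2 * Complex H (\<tau> * h))" "\<i> * of_real (sqrt \<kappa>)"]
    by (simp add: qq F_vec hopf_vec kappa_sqrt)
  have NX: "N q \<bullet> dif F q u = (- (\<kappa> / (2 * \<tau>)) * H * h * c + \<kappa> / (4 * \<tau>) *
    (4 * \<tau> * H * (h * k + g * (1 - h\<^sup>2)) + d * h * r)) / D h"
    unfolding qq N_vec inX[unfolded qq] using kappa
    by (simp add: field_simps kappa_sqrt D0 tau)
  show "berger_metric \<kappa> \<tau> (F q) (N q) (dif F q u) = 0"
    unfolding berger_metric_def epsilon_eq NV VX NX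
    using D0 tau
    by (simp add: field_simps c_def g_def s_sq[OF D])
      (simp add: D_def d_def P_def algebra_simps power2_eq_square kappa_sqrt)
qed

lemma differentiable_F: "q \<in> S2 \<Longrightarrow> F differentiable (at q)"
  and differentiable_N: "q \<in> S2 \<Longrightarrow> N differentiable (at q)"
proof -
  have "f differentiable (at q)" if "smooth_on_S2 f" "q \<in> S2" for f :: "complex \<times> real \<Rightarrow> complex \<times> complex"
    using that unfolding smooth_on_S2_def smooth_on_open_def by (metis Ck_on.simps(2) subsetD)
  then show "q \<in> S2 \<Longrightarrow> F differentiable (at q)" "q \<in> S2 \<Longrightarrow> N differentiable (at q)"
    using smooth_F smooth_N by blast+
qed

section \<open>The trace of the second fundamental form\<close>

definition induced :: "complex \<times> real \<Rightarrow> complex \<times> real \<Rightarrow> complex \<times> real \<Rightarrow> real" where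
  "induced q u v = berger_metric \<kappa> \<tau> (F q) (dif F q u) (dif F q v)"

text \<open>In an orthonormal frame the trace of \<open>induced\<close> is 2, so mean curvature
  \<open>H\<close> means that this form has trace zero.\<close>

definition deviation :: "complex \<times> real \<Rightarrow> complex \<times> real \<Rightarrow> complex \<times> real \<Rightarrow> real" where
  "deviation q u v = second_fundamental_form \<kappa> \<tau> F N q u v - H * induced q u v"

lemma bilinear_forms:
  assumes "q \<in> S2"
  shows "bilinear (induced q)" "bilinear (deviation q)"
proof -
  have F: "linear (dif F q)" and N: "linear (dif N q)"
    using linear_frechet_derivative differentiable_F differentiable_N assms by blast+
  have hopf: "hopf_field (x + y) = hopf_field x + hopf_field y" "hopf_field (c *\<^sub>R x) = c *\<^sub>R hopf_field x" for x y c
    using bounded_linear.linear[OF hopf_field_linear] by (simp_all add: linear_add linear_scale)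
  note lin = F[THEN linear_add] F[THEN linear_scale] N[THEN linear_add] N[THEN linear_scale] hopf inner_add_left inner_add_right
  show "bilinear (induced q)"
    unfolding bilinear_def linear_iff induced_def berger_metric_def
    by (simp add: lin algebra_simps)
  show "bilinear (deviation q)"
    unfolding bilinear_def linear_iff deviation_def induced_def berger_metric_def
      second_fundamental_form_def levi_civita_eq
    by (simp add: lin algebra_simps add_divide_distrib)
qed

text \<open>\<open>e\<close> is the rotation field; \<open>f\<close> is the meridian field, scaled so that its image is polynomial.\<close>

lemma trace_identity_regular:
  assumes q: "(\<zeta>, h) \<in> S2" and "\<zeta> \<noteq> 0"
  defines "e \<equiv> (\<i> * \<zeta>, 0)" and "f \<equiv> (of_real (- h * (D h / (2 * P))) * \<zeta>, D h / (2 * P) * (1 - h\<^sup>2))"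
  shows "deviation (\<zeta>, h) e e * induced (\<zeta>, h) f f
     - (deviation (\<zeta>, h) e f + deviation (\<zeta>, h) f e) * induced (\<zeta>, h) e f
     + deviation (\<zeta>, h) f f * induced (\<zeta>, h) e e = 0"
proof -
  have D: "D h > 0" using D_pos[OF S2_height[OF q]] .
  have nz: "D h \<noteq> 0" "\<kappa> \<noteq> 0" "P \<noteq> 0" "s h \<noteq> 0" using D kappa P_pos s_pos[OF D] by auto
  define m where "m = 1 - h\<^sup>2"
  \<comment> \<open>Squares of \<open>h\<close> are traded for \<open>m\<close>, the squared radius
    of the parallel, to reach a normal form.\<close>
  have h2: "h * h = 1 - m" "h * (h * x) = (1 - m) * x" for x
    by (simp_all add: m_def power2_eq_square algebra_simps)
  have Dm: "D h = 4 * P - d * m" using D_alt by (simp add: m_def)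
  have ss: "s h ^ 3 * D h = s h"
    using s_sq[OF D] nz by (simp add: power3_eq_cube power2_eq_square field_simps)
  have Fe: "dif F (\<zeta>, h) e = vec \<zeta> h 0 (\<i> * of_real (sqrt \<kappa>))"
    by (simp add: e_def dif_F[OF D] vec_def)
  have Ff: "dif F (\<zeta>, h) f = vec \<zeta> h (of_real (\<kappa> * m / \<tau>) * \<i>) (of_real (- 2 * h * sqrt \<kappa>))"
  proof -
    have 1: "2 * \<kappa> * P / \<tau> * (s h)\<^sup>2 * (D h / (2 * P) * m) = \<kappa> * m / \<tau>"
      using nz tau by (simp add: s_sq[OF D])
    have "s h * (h * (D h / (2 * P))) + d * h * (D h * s h ^ 3) / (2 * P) * m = s h * h * (D h + d * m) / (2 * P)"
      using ss nz by (simp add: field_simps)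
    \<comment> \<open>The cancellation is \<open>D h + d * m = 4 * P\<close>; it accounts for the
      factor \<open>D h / (2 * P)\<close> in \<open>f\<close>.\<close>
    also have "\<dots> = 2 * h * s h" using nz by (simp add: Dm)
    finally have 2: "s h * (h * (D h / (2 * P))) + d * h * s h ^ 3 * (D h / (2 * P) * m) = 2 * h * s h"
      by (simp add: mult_ac)
    have "complex_of_real (s h) * (of_real (- h * (D h / (2 * P))) * \<zeta>) - of_real (d * h * s h ^ 3 * (D h / (2 * P) * m)) * \<zeta>
       = - of_real (s h * (h * (D h / (2 * P))) + d * h * s h ^ 3 * (D h / (2 * P) * m)) * \<zeta>"
      by (simp add: algebra_simps)
    also have "\<dots> = of_real (- 2 * h) * (of_real (s h) * \<zeta>)"
      unfolding 2 by simp
    finally show ?thesis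
      unfolding f_def dif_F[OF D] vec_def m_def[symmetric] 1 by (simp add: mult_ac)
  qed
  have Ne: "dif N (\<zeta>, h) e = vec \<zeta> h 0 (\<i> * (of_real (sqrt \<kappa> / (4 * \<tau>)) * Complex (- 4 * \<tau> * H) (d * h)))"
    by (simp add: e_def dif_N[OF D] vec_def)
  have Nf: "dif N (\<zeta>, h) f = vec \<zeta> h (of_real (- \<kappa> * m / (4 * \<tau>)) * Complex (d * h / \<tau>) (4 * H))
     (of_real (sqrt \<kappa> / (4 * \<tau>)) * (\<i> * of_real (d * m * D h / (2 * P)) - of_real (2 * h) * Complex (- 4 * \<tau> * H) (d * h)))"
  proof -
    have 1: "- \<kappa> / (2 * \<tau>) * P * (s h)\<^sup>2 * (D h / (2 * P) * m) = - \<kappa> * m / (4 * \<tau>)"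
      using nz tau by (simp add: s_sq[OF D])
    have "s h * (h * (D h / (2 * P))) + d * h * (D h * s h ^ 3) / (2 * P) * m = s h * h * (D h + d * m) / (2 * P)"
      using ss nz by (simp add: field_simps)
    also have "\<dots> = 2 * h * s h" using nz by (simp add: Dm)
    finally have 2: "s h * (h * (D h / (2 * P))) + d * h * s h ^ 3 * (D h / (2 * P) * m) = 2 * h * s h"
      by (simp add: mult_ac)
    have "C * of_real (s h) * (of_real (- h * c) * \<zeta>) + of_real t * (\<i> * of_real (d * s h) - C * of_real (d * h * s h ^ 3)) * \<zeta>
      = \<i> * of_real (d * t) * (of_real (s h) * \<zeta>) - C * of_real (s h * (h * c) + d * h * s h ^ 3 * t) * \<zeta>" for C and c t :: real
      by (simp add: algebra_simps)
    note 3 = this[of _ "D h / (2 * P)" "D h / (2 * P) * m", unfolded 2]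
    show ?thesis
      unfolding f_def dif_N[OF D] vec_def m_def[symmetric] 1 3 by (simp add: algebra_simps)
  qed
  note V = N_vec F_vec Fe Ff Ne Nf hopf_vec inner_vec[OF q]
  note defs = deviation_def induced_def second_fundamental_form_def levi_civita_eq berger_metric_def epsilon_eq
  \<comment> \<open>The Euclidean products up to \<open>NV\<close> are all that
    \<open>berger_metric_def\<close> and \<open>levi_civita_eq\<close> require.\<close>
  have NeFe: "dif N (\<zeta>, h) e \<bullet> dif F (\<zeta>, h) e = - \<kappa> * H * m / D h"
    unfolding V m_def[symmetric] using kappa tau nz
    by (simp add: inner_complex_def kappa_sqrt power2_eq_square h2 field_simps)
  have NeFf: "dif N (\<zeta>, h) e \<bullet> dif F (\<zeta>, h) f = \<kappa> * d * h\<^sup>2 * m / (2 * \<tau>) / D h"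
    unfolding V m_def[symmetric] using kappa tau nz
    by (simp add: inner_complex_def kappa_sqrt power2_eq_square h2 field_simps)
  have NfFe: "dif N (\<zeta>, h) f \<bullet> dif F (\<zeta>, h) e = \<kappa> * m / (4 * \<tau>) * (d * m * D h / (2 * P) - 2 * d * h\<^sup>2) / D h"
    unfolding V m_def[symmetric] using kappa tau nz
    by (simp add: inner_complex_def kappa_sqrt power2_eq_square h2 field_simps)
  have NfFf: "dif N (\<zeta>, h) f \<bullet> dif F (\<zeta>, h) f = - \<kappa> * H * m * (\<kappa> * m / \<tau>\<^sup>2 + 4 * h\<^sup>2) / D h"
    unfolding V m_def[symmetric] using kappa tau nz
    by (simp add: inner_complex_def kappa_sqrt power2_eq_square h2 field_simps)
  have NeV: "dif N (\<zeta>, h) e \<bullet> hopf_field (F (\<zeta>, h)) = - \<kappa> * H * m / D h"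
    unfolding V m_def[symmetric] using kappa tau nz
    by (simp add: inner_complex_def kappa_sqrt power2_eq_square h2 field_simps)
  have NfV: "dif N (\<zeta>, h) f \<bullet> hopf_field (F (\<zeta>, h)) = \<kappa> * m / (4 * \<tau>) * (d * m * D h / (2 * P) - 8 * H\<^sup>2) / D h"
    unfolding V m_def[symmetric] using kappa tau nz
    by (simp add: inner_complex_def kappa_sqrt power2_eq_square h2 field_simps)
  have FeV: "dif F (\<zeta>, h) e \<bullet> hopf_field (F (\<zeta>, h)) = \<kappa> * m / D h"
    unfolding V m_def[symmetric] using kappa tau nz
    by (simp add: inner_complex_def kappa_sqrt power2_eq_square h2 field_simps)
  have FfV: "dif F (\<zeta>, h) f \<bullet> hopf_field (F (\<zeta>, h)) = 2 * \<kappa> * H * m / \<tau> / D h"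
    unfolding V m_def[symmetric] using kappa tau nz
    by (simp add: inner_complex_def kappa_sqrt power2_eq_square h2 field_simps)
  have FeFe: "dif F (\<zeta>, h) e \<bullet> dif F (\<zeta>, h) e = \<kappa> * m / D h"
    unfolding V m_def[symmetric] using kappa tau nz
    by (simp add: inner_complex_def kappa_sqrt power2_eq_square h2 field_simps)
  have FeFf: "dif F (\<zeta>, h) e \<bullet> dif F (\<zeta>, h) f = 0"
    unfolding V m_def[symmetric] using kappa tau nz
    by (simp add: inner_complex_def kappa_sqrt power2_eq_square h2 field_simps)
  have FfFf: "dif F (\<zeta>, h) f \<bullet> dif F (\<zeta>, h) f = \<kappa> * m * (\<kappa> * m / \<tau>\<^sup>2 + 4 * h\<^sup>2) / D h"
    unfolding V m_def[symmetric] using kappa tau nz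
    by (simp add: inner_complex_def kappa_sqrt power2_eq_square h2 field_simps)
  have FehFe: "dif F (\<zeta>, h) e \<bullet> hopf_field (dif F (\<zeta>, h) e) = 0"
    unfolding V m_def[symmetric] using kappa tau nz
    by (simp add: inner_complex_def kappa_sqrt power2_eq_square h2 field_simps)
  have FfhFf: "dif F (\<zeta>, h) f \<bullet> hopf_field (dif F (\<zeta>, h) f) = 0"
    unfolding V m_def[symmetric] using kappa tau nz
    by (simp add: inner_complex_def kappa_sqrt power2_eq_square h2 field_simps)
  have FehFf: "dif F (\<zeta>, h) e \<bullet> hopf_field (dif F (\<zeta>, h) f) = - 2 * \<kappa> * h * m / D h"
    unfolding V m_def[symmetric] using kappa tau nz
    by (simp add: inner_complex_def kappa_sqrt power2_eq_square h2 field_simps)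
  have FfhFe: "dif F (\<zeta>, h) f \<bullet> hopf_field (dif F (\<zeta>, h) e) = 2 * \<kappa> * h * m / D h"
    unfolding V m_def[symmetric] using kappa tau nz
    by (simp add: inner_complex_def kappa_sqrt power2_eq_square h2 field_simps)
  have FehN: "dif F (\<zeta>, h) e \<bullet> hopf_field (N (\<zeta>, h)) = - \<kappa> * H * m / D h"
    unfolding V m_def[symmetric] using kappa tau nz
    by (simp add: inner_complex_def kappa_sqrt power2_eq_square h2 field_simps)
  have \<kappa>m: "\<kappa> * m + 4 * \<tau>\<^sup>2 * h\<^sup>2 = D h - 4 * H\<^sup>2"
    by (simp add: D_def d_def m_def algebra_simps)
  have "dif F (\<zeta>, h) f \<bullet> hopf_field (N (\<zeta>, h)) = m / (2 * \<tau>) * \<kappa> * (\<kappa> + d * h\<^sup>2) / D h"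
    unfolding V m_def[symmetric] using kappa tau nz
    by (simp add: inner_complex_def kappa_sqrt power2_eq_square field_simps)
  then have FfhN: "dif F (\<zeta>, h) f \<bullet> hopf_field (N (\<zeta>, h)) = \<kappa> * m / (2 * \<tau>) * (D h - 4 * H\<^sup>2) / D h"
    by (simp add: D_def)
  have "N (\<zeta>, h) \<bullet> hopf_field (F (\<zeta>, h)) = - \<kappa> * h / (4 * \<tau>) * (4 * H\<^sup>2 + 4 * \<tau>\<^sup>2 - d * m) / D h"
    unfolding V m_def[symmetric] using kappa tau nz
    by (simp add: inner_complex_def kappa_sqrt power2_eq_square field_simps)
  then have NV: "N (\<zeta>, h) \<bullet> hopf_field (F (\<zeta>, h)) = - \<kappa> * h / (4 * \<tau>)"
    using nz by (simp add: Dm P_def)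
  note inners = NeFe NeFf NfFe NfFf NeV NfV FeV FfV FeFe FeFf FfFf FehFe FfhFf FehFf FfhFe FehN FfhN NV
  have Gee: "induced (\<zeta>, h) e e = 4 * m * (D h + d * m) / (D h)\<^sup>2"
    and Gef: "induced (\<zeta>, h) e f = 8 * d * H * m\<^sup>2 / \<tau> / (D h)\<^sup>2"
    and Gff: "induced (\<zeta>, h) f f = 4 * m * ((\<kappa> * m / \<tau>\<^sup>2 + 4 * h\<^sup>2) * D h + 4 * d * H\<^sup>2 * m / \<tau>\<^sup>2) / (D h)\<^sup>2"
    unfolding induced_def berger_metric_def epsilon_eq inners using nz tau
    by (simp_all add: field_simps power2_eq_square)
  note defs = deviation_def second_fundamental_form_def levi_civita_eq epsilon_eq inners Gee Gef Gff inner_commute[of "dif F (\<zeta>, h) f" "dif F (\<zeta>, h) e"]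
  have Kee: "deviation (\<zeta>, h) e e = 4 * d * H * m\<^sup>2 / (D h)\<^sup>2"
    and Kef: "deviation (\<zeta>, h) e f = - 2 * d * m\<^sup>2 * (D h - 4 * H\<^sup>2) / \<tau> / (D h)\<^sup>2"
    unfolding defs using nz tau
    by (simp_all add: field_simps power2_eq_square)
  have Gfe: "induced (\<zeta>, h) f e = induced (\<zeta>, h) e f"
    by (simp add: induced_def berger_metric_commute)
  \<comment> \<open>This entry is computed from the derivative of \<open>N\<close> along
    \<open>f\<close>. It agrees with \<open>Kef\<close>, as symmetry demands, once
    \<open>D h + d * m = 4 * P\<close> is inserted.\<close>
  have "deviation (\<zeta>, h) f e = - d * m\<^sup>2 * (D h * (D h + d * m) / (2 * P) - 8 * H\<^sup>2) / \<tau> / (D h)\<^sup>2"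
    unfolding defs Gfe using nz tau
    by (simp add: field_simps power2_eq_square)
  also have "D h * (D h + d * m) / (2 * P) = 2 * D h"
    using nz by (simp add: Dm)
  finally have Kfe: "deviation (\<zeta>, h) f e = - 2 * d * m\<^sup>2 * (D h - 4 * H\<^sup>2) / \<tau> / (D h)\<^sup>2"
    by (simp add: algebra_simps)
  have "deviation (\<zeta>, h) f f = - d * H * m\<^sup>2 * (4 * D h * P - 16 * H\<^sup>2 * P + d * m * D h) / (\<tau>\<^sup>2 * P) / (D h)\<^sup>2"
    unfolding defs using nz tau
    by (simp add: field_simps power2_eq_square)
  moreover have "4 * D h * P - 16 * H\<^sup>2 * P + d * m * D h = 16 * P * \<tau>\<^sup>2 - d\<^sup>2 * m\<^sup>2"
    unfolding Dm by (simp add: P_def algebra_simps power2_eq_square)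
  ultimately have Kff: "deviation (\<zeta>, h) f f = - d * H * m\<^sup>2 * (16 * P * \<tau>\<^sup>2 - d\<^sup>2 * m\<^sup>2) / (\<tau>\<^sup>2 * P) / (D h)\<^sup>2"
    by simp
  \<comment> \<open>By \<open>\<kappa>m\<close> the left side is
    \<open>(D + d m)^2 - 4 H^2 (D + d m) - 16 P \<tau>^2\<close>, that is
    \<open>16 P (P - H^2 - \<tau>^2)\<close>. It is the factor left over in the trace
    expression.\<close>
  have "D h * (\<kappa> * m + 4 * \<tau>\<^sup>2 * h\<^sup>2) + 2 * d * m * D h - 4 * d * m * H\<^sup>2 - 16 * P * \<tau>\<^sup>2 + d\<^sup>2 * m\<^sup>2 = 0"
    unfolding \<kappa>m Dm by (simp add: P_def algebra_simps power2_eq_square)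
  moreover have "deviation (\<zeta>, h) e e * induced (\<zeta>, h) f f
     - (deviation (\<zeta>, h) e f + deviation (\<zeta>, h) f e) * induced (\<zeta>, h) e f
     + deviation (\<zeta>, h) f f * induced (\<zeta>, h) e e = 16 * d * H * m ^ 3 / (\<tau>\<^sup>2 * (D h) ^ 4) *
       (D h * (\<kappa> * m + 4 * \<tau>\<^sup>2 * h\<^sup>2) + 2 * d * m * D h - 4 * d * m * H\<^sup>2 - 16 * P * \<tau>\<^sup>2 + d\<^sup>2 * m\<^sup>2)"
  proof -
    \<comment> \<open>In this form the factor \<open>P\<close> cancels the denominator
      \<open>P\<close> of \<open>Kff\<close>.\<close>
    have Gee': "induced (\<zeta>, h) e e = 16 * P * m / (D h)\<^sup>2"
      unfolding Gee Dm by simp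
    show ?thesis
      unfolding Gee' Gef Gff Kee Kef Kfe Kff using nz tau
      by (simp add: field_simps power2_eq_square power3_eq_cube power4_eq_xxxx)
  qed
  ultimately show ?thesis by simp
qed

text \<open>The rotation and meridian fields vanish at a pole, so a constant basis of the horizontal
  plane replaces them. The diagonal entries of the deviation vanish there, and the basis is
  orthogonal, which removes the mixed term.\<close>

lemma trace_identity_pole:
  assumes q: "(0, h) \<in> S2"
  defines "e \<equiv> (1, 0)" and "f \<equiv> (\<i>, 0)"
  shows "deviation (0, h) e e * induced (0, h) f f
     - (deviation (0, h) e f + deviation (0, h) f e) * induced (0, h) e f
     + deviation (0, h) f f * induced (0, h) e e = 0"
proof -
  have D: "D h > 0" using D_pos[OF S2_height[OF q]] .
  have F: "dif F (0, h) (v, 0) = (0, of_real (sqrt \<kappa> * s h) * v)" for v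
    by (simp add: dif_F[OF D])
  have N: "dif N (0, h) (v, 0) = (0, of_real (sqrt \<kappa> * s h / (4 * \<tau>)) * Complex (- 4 * \<tau> * H) (d * h) * v)" for v
    by (simp add: dif_N[OF D])
  have p: "snd (F (0, h)) = 0" "snd (N (0, h)) = 0"
    by (simp_all add: F_def N_def)
  have G: "induced (0, h) (v, 0) (v', 0) = 4 / \<kappa> * (\<kappa> * (s h)\<^sup>2 * (v \<bullet> v'))" for v v'
    using kappa by (simp add: induced_def berger_metric_def F p hopf_field_def inner_prod_def inner_complex_def
        algebra_simps power2_eq_square kappa_sqrt)
  have K: "deviation (0, h) (v, 0) (v, 0) = 0" for v
    unfolding deviation_def second_fundamental_form_def levi_civita_eq G F N
    using kappa tau by (simp add: p hopf_field_def inner_prod_def inner_complex_def kappa_sqrt field_simps power2_eq_square)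
  show ?thesis
    unfolding e_def f_def by (simp add: K) (simp add: G inner_complex_def)
qed

lemma tangent_space_iff: "(v, k) \<in> tangent_space (\<zeta>, h) \<longleftrightarrow> \<zeta> \<bullet> v = - h * k"
  by (auto simp: tangent_space_def)

text \<open>The fields \<open>e\<close>, \<open>f\<close> of the trace identities span the tangent
  plane, so any orthonormal frame is a combination of them and \<open>trace_form_eq_0\<close>
  applies.\<close>

lemma trace_deviation:
  assumes q: "q \<in> S2" and "orthonormal_frame \<kappa> \<tau> F q u v"
  shows "deviation q u u + deviation q v v = 0"
proof -
  obtain \<zeta> h where qq: "q = (\<zeta>, h)" by force
  have G: "u \<in> tangent_space q" "v \<in> tangent_space q" "induced q u u = 1" "induced q v v = 1" "induced q u v = 0"
    using assms(2) by (auto simp: orthonormal_frame_def induced_def)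
  have sym: "induced q x y = induced q y x" for x y
    by (simp add: induced_def berger_metric_commute)
  note trace = trace_form_eq_0[OF bilinear_forms(2,1)[OF q] _ _ sym G(3-5)]
  have D: "D h > 0" using D_pos[OF S2_height] q qq by simp
  show ?thesis
  proof (cases "\<zeta> = 0")
    case True
    then have "\<bar>h\<bar> = 1" using q unfolding qq S2_iff by (simp add: abs_square_eq_1)
    then have "h \<noteq> 0" by auto
    have "\<exists>a b. x = a *\<^sub>R (1, 0) + b *\<^sub>R (\<i>, 0)" if "x \<in> tangent_space q" for x
    proof -
      obtain w k where x: "x = (w, k)" by force
      then have "k = 0" using that True \<open>h \<noteq> 0\<close> by (simp add: qq tangent_space_iff)
      then show ?thesis
        by (intro exI[of _ "Re w"] exI[of _ "Im w"]) (simp add: x complex_eq_iff)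
    qed
    then show ?thesis
      using trace_identity_pole trace G(1,2) q unfolding qq True by metis
  next
    case False
    define m where "m = 1 - h\<^sup>2"
    define c where "c = D h / (2 * P)"
    have m: "(cmod \<zeta>)\<^sup>2 = m" using q unfolding qq S2_iff m_def by simp
    then have m0: "m \<noteq> 0" "c \<noteq> 0" using False D P_pos by (auto simp: c_def)
    have "\<exists>a b. x = a *\<^sub>R (\<i> * \<zeta>, 0) + b *\<^sub>R (of_real (- h * c) * \<zeta>, c * (1 - h\<^sup>2))"
      if "x \<in> tangent_space q" for x
    proof -
      obtain w k where x: "x = (w, k)" by force
      have k: "\<zeta> \<bullet> w = - h * k" using that by (simp add: x qq tangent_space_iff)
      \<comment> \<open>\<zeta> and \<open>i \<zeta>\<close> are orthogonal with squared length
        \<open>m\<close>; tangency then turns the \<zeta>-component into a multiple of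
        \<open>f\<close>.\<close>
      have "m *\<^sub>R w = ((\<i> * \<zeta>) \<bullet> w) *\<^sub>R (\<i> * \<zeta>) + (\<zeta> \<bullet> w) *\<^sub>R \<zeta>"
        unfolding m[symmetric] cmod_power2 complex_eq_iff
        by (simp add: inner_complex_def algebra_simps power2_eq_square)
      then have "w = (1 / m) *\<^sub>R (((\<i> * \<zeta>) \<bullet> w) *\<^sub>R (\<i> * \<zeta>) + (\<zeta> \<bullet> w) *\<^sub>R \<zeta>)"
        using m0 by (simp add: eq_vector_fraction_iff flip: divide_inverse)
      also have "\<dots> = ((\<i> * \<zeta>) \<bullet> w / m) *\<^sub>R (\<i> * \<zeta>) + (k / (c * m)) *\<^sub>R (of_real (- h * c) * \<zeta>)"
        using m0 by (simp add: k scaleR_conv_of_real scaleR_add_right algebra_simps)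
      finally show ?thesis
        using m0 by (intro exI[of _ "(\<i> * \<zeta>) \<bullet> w / m"] exI[of _ "k / (c * m)"]) (simp add: x m_def)
    qed
    then show ?thesis
      using trace_identity_regular[of \<zeta> h] False trace G(1,2) q unfolding qq c_def by metis
  qed
qed

lemma cmc_F: "has_constant_mean_curvature \<kappa> \<tau> F H"
  unfolding has_constant_mean_curvature_def
proof (intro exI[of _ N] conjI unit_normal_N ballI allI impI)
  fix q u v assume "q \<in> S2" and frame: "orthonormal_frame \<kappa> \<tau> F q u v"
  then have "deviation q u u + deviation q v v = 0" by (rule trace_deviation)
  then show "(second_fundamental_form \<kappa> \<tau> F N q u u + second_fundamental_form \<kappa> \<tau> F N q v v) / 2 = H"
    using frame by (simp add: deviation_def induced_def orthonormal_frame_def)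
qed

subsection \<open>The parametrization \<open>\<Phi>\<close>\<close>

abbreviation a where "a \<equiv> a_bound \<kappa> H"
abbreviation L where "L \<equiv> lam \<kappa> \<tau> H"

definition Y :: "real \<Rightarrow> real" where "Y h = - arctan (\<tau> / H * h) + \<beta> h"

definition height :: "real \<Rightarrow> real" where "height x = sgn x * L (a - \<bar>x\<bar>)"

lemma a_bounds: "0 < a" "a < pi / 2" and tan_a: "tan a = sqrt \<kappa> / (2 * H)"
proof -
  show "a < pi / 2" unfolding a_bound_def by (rule arctan_ubound)
qed (use kappa H in \<open>simp_all add: a_bound_def tan_arctan\<close>)

lemma y_profile_eq: "y_profile \<kappa> \<tau> H x = Y (L x)"
  using d_neq_0 by (auto simp: y_profile_def Y_def \<beta>_def d_def)

section \<open>The function \<lambda> and its inverse\<close>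

lemma tan_bounds:
  assumes "r \<in> {0..a}"
  shows "0 \<le> tan r" "4 * H\<^sup>2 / \<kappa> * (tan r)\<^sup>2 \<le> 1" "4 * H\<^sup>2 / \<kappa> * (tan r)\<^sup>2 = 1 \<longleftrightarrow> r = a" "cos r > 0"
proof -
  show 0: "0 \<le> tan r" using assms a_bounds tan_gt_zero[of r] by (cases "r = 0") auto
  show "cos r > 0" using assms a_bounds by (intro cos_gt_zero_pi) auto
  have le: "tan r \<le> sqrt \<kappa> / (2 * H)"
    using tan_mono_le[of r a] assms a_bounds unfolding tan_a by auto
  have eq: "tan r = sqrt \<kappa> / (2 * H) \<longleftrightarrow> r = a"
  proof
    assume "tan r = sqrt \<kappa> / (2 * H)"
    then have "arctan (tan r) = a" by (simp add: a_bound_def)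
    then show "r = a" using assms a_bounds by (simp add: arctan_tan)
  qed (simp add: tan_a)
  have sq: "4 * H\<^sup>2 / \<kappa> * (sqrt \<kappa> / (2 * H))\<^sup>2 = 1"
    using kappa H by (simp add: power_divide power_mult_distrib)
  have pos: "4 * H\<^sup>2 / \<kappa> > 0" using kappa H by simp
  have nn: "0 \<le> sqrt \<kappa> / (2 * H)" using kappa H by simp
  show "4 * H\<^sup>2 / \<kappa> * (tan r)\<^sup>2 \<le> 1"
    using power_mono[OF le 0, of 2] pos sq by (metis mult_left_mono less_imp_le)
  show "4 * H\<^sup>2 / \<kappa> * (tan r)\<^sup>2 = 1 \<longleftrightarrow> r = a"
    unfolding eq[symmetric] using sq pos 0 nn
    by (metis mult_cancel_left less_irrefl power2_eq_iff_nonneg)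
qed

lemma L_bounds:
  assumes "r \<in> {0..a}"
  shows "0 \<le> L r" "(L r)\<^sup>2 * (1 + 4 * \<tau>\<^sup>2 / \<kappa> * (tan r)\<^sup>2) = 1 - 4 * H\<^sup>2 / \<kappa> * (tan r)\<^sup>2" "L r = 0 \<longleftrightarrow> r = a"
proof -
  have pos: "1 + 4 * \<tau>\<^sup>2 / \<kappa> * (tan r)\<^sup>2 > 0"
    using kappa by (intro add_pos_nonneg) auto
  show "0 \<le> L r"
    using tan_bounds(2)[OF assms] pos by (simp add: lam_def)
  show "(L r)\<^sup>2 * (1 + 4 * \<tau>\<^sup>2 / \<kappa> * (tan r)\<^sup>2) = 1 - 4 * H\<^sup>2 / \<kappa> * (tan r)\<^sup>2"
    using tan_bounds(2)[OF assms] pos by (simp add: lam_def power_divide)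
  show "L r = 0 \<longleftrightarrow> r = a"
    using tan_bounds(3)[OF assms] pos by (auto simp: lam_def)
qed

text \<open>The definition of \<lambda> squared and cleared of denominators. It determines the
  squared tangent from \<lambda> and conversely, which gives both injectivity and
  surjectivity.\<close>

lemma tan_sq: "r \<in> {0..a} \<Longrightarrow> (tan r)\<^sup>2 * (4 * (H\<^sup>2 + \<tau>\<^sup>2 * (L r)\<^sup>2)) = \<kappa> * (1 - (L r)\<^sup>2)"
  using L_bounds(2)[of r] kappa by (simp add: field_simps)

lemma sq_sum_pos: "H\<^sup>2 + \<tau>\<^sup>2 * h\<^sup>2 > 0"
  using H by (intro add_pos_nonneg) auto

lemma L_le_1: "r \<in> {0..a} \<Longrightarrow> L r \<le> 1"
proof -
  assume r: "r \<in> {0..a}"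
  have "0 \<le> \<kappa> * (1 - (L r)\<^sup>2)"
    unfolding tan_sq[OF r, symmetric] using sq_sum_pos[of "L r"] by simp
  then have "(L r)\<^sup>2 \<le> 1" using kappa by (simp add: zero_le_mult_iff)
  then show "L r \<le> 1" unfolding abs_square_le_1 by simp
qed

lemma inj_L: "inj_on L {0..a}"
proof (rule inj_onI)
  fix r r' assume r: "r \<in> {0..a}" "r' \<in> {0..a}" and eq: "L r = L r'"
  define c where "c = 4 * (H\<^sup>2 + \<tau>\<^sup>2 * (L r')\<^sup>2)"
  have "(tan r)\<^sup>2 * c = (tan r')\<^sup>2 * c"
    using tan_sq[OF r(1)] tan_sq[OF r(2)] unfolding eq c_def by simp
  moreover have "c > 0" unfolding c_def using sq_sum_pos[of "L r'"] by simp
  ultimately have "(tan r)\<^sup>2 = (tan r')\<^sup>2" by simp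
  then have "tan r = tan r'" using tan_bounds(1)[OF r(1)] tan_bounds(1)[OF r(2)] by simp
  moreover have "arctan (tan x) = x" if "x \<in> {0..a}" for x
    using that a_bounds by (intro arctan_tan) auto
  ultimately show "r = r'" using r by metis
qed

lemma L_surj:
  assumes "0 \<le> h" "h \<le> 1"
  obtains r where "r \<in> {0..a}" "L r = h"
proof -
  \<comment> \<open>\<open>T\<close> is the squared tangent that \<open>tan_sq\<close> prescribes
    for \<lambda> equal to \<open>h\<close>.\<close>
  define T where "T = \<kappa> * (1 - h\<^sup>2) / (4 * (H\<^sup>2 + \<tau>\<^sup>2 * h\<^sup>2))"
  define r where "r = arctan (sqrt T)"
  have h: "h\<^sup>2 \<le> 1" using assms by (simp add: abs_square_le_1)
  have T0: "T \<ge> 0" using h kappa sq_sum_pos[of h] by (auto simp: T_def intro!: divide_nonneg_pos mult_nonneg_nonneg)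
  have "T \<le> \<kappa> / (4 * H\<^sup>2)"
  proof -
    have "T \<le> \<kappa> * 1 / (4 * (H\<^sup>2 + \<tau>\<^sup>2 * h\<^sup>2))"
      unfolding T_def using kappa sq_sum_pos[of h] by (intro divide_right_mono mult_left_mono) auto
    also have "\<dots> \<le> \<kappa> / (4 * H\<^sup>2)"
      using kappa H by (intro frac_le) auto
    finally show ?thesis .
  qed
  then have "sqrt T \<le> sqrt (\<kappa> / (4 * H\<^sup>2))" by simp
  also have "sqrt (\<kappa> / (4 * H\<^sup>2)) = sqrt \<kappa> / (2 * H)"
    using H by (simp add: real_sqrt_divide real_sqrt_mult)
  finally have "sqrt T \<le> sqrt \<kappa> / (2 * H)" .
  then have r: "r \<in> {0..a}"
    using T0 by (auto simp: r_def a_bound_def arctan_le_iff)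
  have tan: "(tan r)\<^sup>2 = T" using T0 by (simp add: r_def tan_arctan)
  have Th: "T * (4 * (H\<^sup>2 + \<tau>\<^sup>2 * h\<^sup>2)) = \<kappa> * (1 - h\<^sup>2)"
    using sq_sum_pos[of h] by (simp add: T_def)
  have pos: "4 * \<tau>\<^sup>2 * T + \<kappa> > 0" using T0 kappa by (simp add: add_nonneg_pos)
  have "T * (4 * (H\<^sup>2 + \<tau>\<^sup>2 * (L r)\<^sup>2)) = \<kappa> * (1 - (L r)\<^sup>2)" using tan_sq[OF r] tan by simp
  \<comment> \<open>For a given tangent, \<open>tan_sq\<close> is linear in the square of \<lambda>
    with positive leading coefficient, so \<open>L r\<close> and \<open>h\<close> have equal
    squares.\<close>
  then have "(4 * \<tau>\<^sup>2 * T + \<kappa>) * ((L r)\<^sup>2 - h\<^sup>2) = 0" using Th by (simp add: algebra_simps)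
  then have "(L r)\<^sup>2 = h\<^sup>2" using pos by simp
  then have "L r = h" using L_bounds(1)[OF r] assms by simp
  then show thesis using that r by blast
qed

text \<open>The moduli of the two components of \<Phi> are those of \<open>F\<close>: in
  \<open>1 + tan^2\<close> the numerators add up to \<open>D\<close>, and all quantities are
  nonnegative, so squares suffice.\<close>

lemma cos_sin_L:
  assumes r: "r \<in> {0..a}"
  shows "cos r = 2 * sqrt (H\<^sup>2 + \<tau>\<^sup>2 * (L r)\<^sup>2) * s (L r)"
    "sin r = sqrt \<kappa> * s (L r) * sqrt (1 - (L r)\<^sup>2)"
proof -
  define h where "h = L r"
  define q where "q = H\<^sup>2 + \<tau>\<^sup>2 * h\<^sup>2"
  have h: "0 \<le> h" "h \<le> 1" unfolding h_def using L_bounds(1)[OF r] L_le_1[OF r] by auto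
  have h2: "h\<^sup>2 \<le> 1" using h by (simp add: abs_square_le_1)
  have D: "D h > 0" using h by (intro D_pos) auto
  have q: "q > 0" unfolding q_def by (rule sq_sum_pos)
  have c: "cos r > 0" by (rule tan_bounds(4)[OF r])
  have tan: "(tan r)\<^sup>2 = \<kappa> * (1 - h\<^sup>2) / (4 * q)"
    using tan_sq[OF r] q unfolding h_def[symmetric] q_def[symmetric] by (simp add: field_simps)
  have Dq: "D h = 4 * q + \<kappa> * (1 - h\<^sup>2)"
    by (simp add: D_def d_def q_def algebra_simps)
  have "(cos r)\<^sup>2 * (1 + (tan r)\<^sup>2) = 1"
    using c by (simp add: tan_def field_simps flip: sin_cos_squared_add)
  then have c2: "(cos r)\<^sup>2 = 4 * q / D h"
    unfolding tan using q D by (simp add: Dq field_simps)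
  have "(cos r)\<^sup>2 = (2 * sqrt q * s h)\<^sup>2"
    unfolding c2 power_mult_distrib s_sq[OF D] using q by simp
  then show "cos r = 2 * sqrt (H\<^sup>2 + \<tau>\<^sup>2 * (L r)\<^sup>2) * s (L r)"
    unfolding h_def[symmetric] q_def[symmetric]
    by (rule power2_eq_imp_eq) (use c q s_pos[OF D] in auto)
  have "(sin r)\<^sup>2 = (sqrt \<kappa> * s h * sqrt (1 - h\<^sup>2))\<^sup>2"
    unfolding sin_squared_eq c2 power_mult_distrib s_sq[OF D] using kappa h2 D by (simp add: Dq field_simps)
  moreover have "sin r \<ge> 0" using r a_bounds by (intro sin_ge_zero) auto
  ultimately show "sin r = sqrt \<kappa> * s (L r) * sqrt (1 - (L r)\<^sup>2)"
    unfolding h_def[symmetric]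
    by (intro power2_eq_imp_eq[of "sin r"]) (use kappa h2 s_pos[OF D] in auto)
qed

section \<open>Identification of \<Phi> with the immersion\<close>

lemma D_minus [simp]: "D (- h) = D h" and s_minus [simp]: "s (- h) = s h"
  by (simp_all add: D_def s_def)

text \<open>Both summands are odd; for \<open>artanh\<close> this is used on the open interval from
  -1 to 1, where positivity of \<open>D h\<close> keeps the argument.\<close>

lemma Y_minus: "D h > 0 \<Longrightarrow> Y (- h) = - Y h"
proof -
  assume h: "D h > 0"
  have "\<bar>sqrt (- d) / sqrt (4 * H\<^sup>2 + \<kappa>) * h\<bar> < 1" if "d \<le> 0"
  proof -
    have R: "4 * H\<^sup>2 + \<kappa> > 0" using kappa by (simp add: add_nonneg_pos)
    have "(sqrt (- d) / sqrt (4 * H\<^sup>2 + \<kappa>) * h)\<^sup>2 < 1"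
      using h that R by (simp add: D_def power_mult_distrib power_divide field_simps)
    then show ?thesis by (simp add: abs_square_less_1)
  qed
  then show ?thesis
    by (simp add: Y_def \<beta>_def arctan_minus)
qed

text \<open>As \<open>H > 0\<close>, the number lies in the right half plane and its argument is an
  arctangent.\<close>

lemma Complex_polar: "Complex H (\<tau> * h) = of_real (sqrt (H\<^sup>2 + \<tau>\<^sup>2 * h\<^sup>2)) * exp (\<i> * of_real (arctan (\<tau> / H * h)))"
proof -
  have "sqrt (1 + (\<tau> / H * h)\<^sup>2) = sqrt (H\<^sup>2 + \<tau>\<^sup>2 * h\<^sup>2) / H"
    using H by (simp add: real_sqrt_divide[symmetric] real_sqrt_unique flip: real_sqrt_abs2)
      (simp add: field_simps power2_eq_square real_sqrt_divide)
  moreover have "sqrt (H\<^sup>2 + \<tau>\<^sup>2 * h\<^sup>2) > 0" using sq_sum_pos by simp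
  ultimately show ?thesis
    using H by (simp add: complex_eq_iff Re_exp Im_exp cos_arctan sin_arctan)
qed

lemma z_polar: "z h = of_real (2 * sqrt (H\<^sup>2 + \<tau>\<^sup>2 * h\<^sup>2) * s h) * exp (- (\<i> * of_real (Y h)))"
proof -
  have "exp (- (\<i> * of_real (Y h))) = exp (\<i> * of_real (arctan (\<tau> / H * h))) * exp (- (\<i> * complex_of_real (\<beta> h)))"
    by (simp add: Y_def algebra_simps flip: exp_add)
  then show ?thesis
    by (simp add: z_def Complex_polar E_def)
qed

lemma height_bounds: "\<bar>x\<bar> \<le> a \<Longrightarrow> \<bar>height x\<bar> \<le> 1"
  using L_bounds(1)[of "a - \<bar>x\<bar>"] L_le_1[of "a - \<bar>x\<bar>"] by (auto simp: height_def abs_mult sgn_if)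

text \<open>Since \<open>Y\<close> is odd, the opposite signs of y in the two branches of \<Phi>
  merge into the single phase \<open>- Y (height x)\<close>.\<close>

lemma Phi_eq: "\<bar>x\<bar> \<le> a \<Longrightarrow> Phi \<kappa> \<tau> H (x, t) = F (sphere_coords height (x, t))"
proof -
  assume x: "\<bar>x\<bar> \<le> a"
  define r where "r = a - \<bar>x\<bar>"
  have r: "r \<in> {0..a}" using x by (simp add: r_def)
  have D: "D (height x) > 0" using height_bounds[OF x] by (rule D_pos)
  have L_a: "L a = 0" using L_bounds(3)[of a] a_bounds by simp
  have h: "height x = (if x < 0 then - L r else L r)"
    using L_a by (auto simp: height_def r_def sgn_if)
  have y: "y_profile \<kappa> \<tau> H r = (if x < 0 then - Y (height x) else Y (height x))"
    using Y_minus[OF D] by (auto simp: y_profile_eq h)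
  have rr: "x + a = r" if "x < 0" using that by (simp add: r_def)
  have rr': "a - x = r" if "\<not> x < 0" using that by (simp add: r_def)
  have sq: "(height x)\<^sup>2 = (L r)\<^sup>2" "s (height x) = s (L r)" by (auto simp: h)
  have "Phi \<kappa> \<tau> H (x, t) = (of_real (cos r) * exp (- (\<i> * of_real (Y (height x)))), of_real (sin r) * exp (\<i> * of_real t))"
    by (auto simp: Phi_def Let_def rr rr' y)
  also have "\<dots> = F (sphere_coords height (x, t))"
    unfolding F_def sphere_coords_def split fst_conv snd_conv z_polar w_def sq cos_sin_L[OF r]
    by simp
  finally show ?thesis .
qed

section \<open>The height is a homeomorphism\<close>

lemma L_a: "L a = 0" and L_0: "L 0 = 1"
  using L_bounds(3)[of a] a_bounds by (simp_all add: lam_def)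

lemma abs_height: "\<bar>x\<bar> \<le> a \<Longrightarrow> \<bar>height x\<bar> = L (a - \<bar>x\<bar>)"
  using L_bounds(1)[of "a - \<bar>x\<bar>"] L_a by (auto simp: height_def abs_mult sgn_if)

text \<open>The modulus of the height determines that of \<open>x\<close>. The height is odd and
  vanishes only at 0, so the sign of \<open>x\<close> is determined as well.\<close>

lemma inj_on_height: "inj_on height {-a..a}"
proof (rule inj_onI)
  fix x x' assume x: "x \<in> {-a..a}" "x' \<in> {-a..a}" and eq: "height x = height x'"
  have "L (a - \<bar>x\<bar>) = L (a - \<bar>x'\<bar>)"
    using abs_height[of x] abs_height[of x'] x eq by auto
  then have "a - \<bar>x\<bar> = a - \<bar>x'\<bar>"
    by (rule inj_onD[OF inj_L]) (use x in auto)
  then have abs: "\<bar>x\<bar> = \<bar>x'\<bar>" by simp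
  show "x = x'"
  proof (cases "x' = - x")
    case True
    then have "height x = 0" using eq by (simp add: height_def sgn_minus)
    then have "L (a - \<bar>x\<bar>) = 0" using abs_height[of x] x by auto
    then have "x = 0" using L_bounds(3)[of "a - \<bar>x\<bar>"] x by auto
    then show ?thesis using True by simp
  next
    case False
    then show ?thesis using abs by linarith
  qed
qed

lemma height_image: "height ` {-a<..<a} = {-1<..<1}"
proof (intro equalityI subsetI)
  fix h assume "h \<in> height ` {-a<..<a}"
  then obtain x where x: "x \<in> {-a<..<a}" "h = height x" by blast
  have "L (a - \<bar>x\<bar>) \<noteq> L 0"
  proof
    assume "L (a - \<bar>x\<bar>) = L 0"
    then have "a - \<bar>x\<bar> = 0"
      by (rule inj_onD[OF inj_L]) (use x a_bounds in auto)
    then show False using x by auto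
  qed
  moreover have "L (a - \<bar>x\<bar>) \<le> 1" using x by (intro L_le_1) auto
  ultimately have "\<bar>height x\<bar> < 1"
    using abs_height[of x] x L_0 by auto
  then show "h \<in> {-1<..<1}" using x by auto
next
  fix h :: real assume h: "h \<in> {-1<..<1}"
  have "\<bar>h\<bar> \<le> 1" using h by auto
  then obtain r where r: "r \<in> {0..a}" "L r = \<bar>h\<bar>"
    by (rule L_surj[OF abs_ge_zero])
  have "r \<noteq> 0" using r h L_0 by auto
  show "h \<in> height ` {-a<..<a}"
  \<comment> \<open>The preimage inverts \<lambda> at the modulus of \<open>h\<close> and restores
    the sign; for \<open>h = 0\<close> it is 0, as \<open>sgn 0 = 0\<close>.\<close>
  proof (intro image_eqI)
    show "sgn h * (a - r) \<in> {-a<..<a}"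
      using r \<open>r \<noteq> 0\<close> a_bounds by (auto simp: sgn_if)
    have "r < a" if "h \<noteq> 0"
      using r L_bounds(3)[OF r(1)] that by (cases "r = a") auto
    then show "h = height (sgn h * (a - r))"
      using r by (cases "h = 0") (auto simp: height_def sgn_mult abs_mult L_a sgn_if)
  qed
qed

lemma continuous_on_L: "continuous_on {0..a} L"
proof -
  have "1 + 4 * \<tau>\<^sup>2 / \<kappa> * (tan r)\<^sup>2 > 0" for r
    using kappa by (intro add_pos_nonneg) auto
  then have "sqrt (1 + 4 * \<tau>\<^sup>2 / \<kappa> * (tan r)\<^sup>2) \<noteq> 0" for r
    by (metis less_irrefl real_sqrt_eq_0_iff)
  moreover have "\<forall>r\<in>{0..a}. cos r \<noteq> 0" using tan_bounds(4) by fastforce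
  ultimately show ?thesis
    unfolding lam_def by (intro continuous_intros) blast+
qed

lemma continuous_on_height: "continuous_on {-a..a} height"
proof -
  have c: "continuous_on {-a..0} (\<lambda>x. - L (a + x))" "continuous_on {0..a} (\<lambda>x. L (a - x))"
    by (intro continuous_on_minus continuous_on_compose2[OF continuous_on_L], auto intro: continuous_intros)+
  have e: "x \<in> {-a..0} \<Longrightarrow> - L (a + x) = height x" "x \<in> {0..a} \<Longrightarrow> L (a - x) = height x" for x
    using L_a by (auto simp: height_def sgn_if)
  have "continuous_on {-a..0} height"
    by (rule continuous_on_eq[OF c(1)]) (erule e)
  moreover have "continuous_on {0..a} height"
    by (rule continuous_on_eq[OF c(2)]) (erule e)
  moreover have "{-a..a} = {-a..0} \<union> {0..a}" using a_bounds by auto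
  ultimately show ?thesis
    by (metis continuous_on_closed_Un closed_real_atLeastAtMost)
qed

text \<open>Continuity of the inverse comes from invariance of domain.\<close>

lemma homeomorphism_height: "\<exists>k. homeomorphism {-a<..<a} {-1<..<1} height k"
proof -
  have "continuous_on {-a<..<a} height" "inj_on height {-a<..<a}"
    using continuous_on_height inj_on_height by (auto intro: continuous_on_subset inj_on_subset)
  then obtain k where "homeomorphism {-a<..<a} (height ` {-a<..<a}) height k"
    by (metis invariance_of_domain_homeomorphism open_greaterThanLessThan order_refl)
  then show ?thesis unfolding height_image by blast
qed

section \<open>Smoothness of the height away from the equator\<close>

definition V :: "real set" where "V = {-a<..<a} - {0}"

lemma V_simps: "open V" "x \<in> V \<Longrightarrow> x \<noteq> 0" "x \<in> V \<Longrightarrow> a - \<bar>x\<bar> \<in> {0..a}" "x \<in> V \<Longrightarrow> 0 < a - \<bar>x\<bar> \<and> a - \<bar>x\<bar> < a"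
  by (auto simp: V_def open_delete)

definition slope :: "real \<Rightarrow> real" where "slope x = tan (a - \<bar>x\<bar>)"
definition damp :: "real \<Rightarrow> real" where "damp x = 1 / (1 + 4 * \<tau>\<^sup>2 / \<kappa> * (slope x)\<^sup>2)"
definition recip :: "real \<Rightarrow> real" where "recip x = 1 / L (a - \<bar>x\<bar>)"
text \<open>The sum \<open>p + q\<close> that appears as a factor when
  \<open>(1 - p t^2) / (1 + q t^2)\<close>, the square of \<lambda>, is differentiated in
  \<open>t\<close>.\<close>

definition pq :: real where "pq = 4 * H\<^sup>2 / \<kappa> + 4 * \<tau>\<^sup>2 / \<kappa>"

lemma damp_pos: "damp x > 0"
proof -
  have "1 + 4 * \<tau>\<^sup>2 / \<kappa> * (slope x)\<^sup>2 > 0"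
    using kappa by (intro add_pos_nonneg) auto
  then show ?thesis by (simp add: damp_def)
qed

lemma pq_pos: "pq > 0"
  unfolding pq_def using kappa H by (intro add_pos_nonneg) auto

lemma L_pos_V: "x \<in> V \<Longrightarrow> L (a - \<bar>x\<bar>) > 0"
  using L_bounds(1,3)[of "a - \<bar>x\<bar>"] V_simps(3,4)[of x] by fastforce

lemma slope_pos: "x \<in> V \<Longrightarrow> slope x > 0"
  unfolding slope_def using V_simps(4)[of x] a_bounds by (intro tan_gt_zero) auto

lemma sgn_deriv: "x \<noteq> 0 \<Longrightarrow> (sgn has_real_derivative 0) (at x)" for x :: real
proof -
  assume "x \<noteq> 0"
  show ?thesis
  proof (cases "x > 0")
    case True
    show ?thesis
      by (rule has_field_derivative_transform_within_open[OF DERIV_const[of 1] open_greaterThan[of 0]]) (use True in auto)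
  next
    case False
    show ?thesis
      by (rule has_field_derivative_transform_within_open[OF DERIV_const[of "-1"] open_lessThan[of 0]]) (use False \<open>x \<noteq> 0\<close> in auto)
  qed
qed

lemma slope_deriv:
  assumes "x \<in> V"
  shows "(slope has_real_derivative - (sgn x * (1 + (slope x)\<^sup>2))) (at x)"
proof -
  have c: "cos (a - \<bar>x\<bar>) \<noteq> 0" using tan_bounds(4)[OF V_simps(3)[OF assms]] by simp
  have "((\<lambda>x. a - \<bar>x\<bar>) has_real_derivative - sgn x) (at x)"
  proof -
    have "((\<lambda>x. a - sgn x * x) has_real_derivative - sgn x) (at x)"
      by (rule DERIV_cong[OF DERIV_diff[OF DERIV_const DERIV_mult[OF sgn_deriv[OF V_simps(2)[OF assms]] DERIV_ident]]]) simp
    moreover have "sgn y * y = \<bar>y\<bar>" for y :: real by (simp add: sgn_if)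
    ultimately show ?thesis by simp
  qed
  from DERIV_chain2[OF DERIV_tan[OF c] this]
  show ?thesis
    unfolding slope_def[abs_def] using tan_sec[OF c] by (simp add: mult_ac power_inverse)
qed

lemma damp_deriv:
  assumes "x \<in> V"
  shows "(damp has_real_derivative 8 * \<tau>\<^sup>2 / \<kappa> * sgn x * slope x * (1 + (slope x)\<^sup>2) * (damp x)\<^sup>2) (at x)"
proof -
  have 1: "1 + 4 * \<tau>\<^sup>2 / \<kappa> * (slope x)\<^sup>2 \<noteq> 0" using damp_pos[of x] by (auto simp: damp_def)
  have "((\<lambda>x. 1 + 4 * \<tau>\<^sup>2 / \<kappa> * (slope x)\<^sup>2) has_real_derivative - (8 * \<tau>\<^sup>2 / \<kappa> * sgn x * slope x * (1 + (slope x)\<^sup>2))) (at x)"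
    using kappa by (auto intro!: derivative_eq_intros slope_deriv[OF assms])
  from DERIV_inverse_fun[OF this 1]
  show ?thesis
    unfolding damp_def[abs_def] by (simp add: inverse_eq_divide power2_eq_square)
qed

text \<open>The square of \<lambda> is differentiated first; the square root is smooth there because
  \<lambda> is positive off the equator.\<close>

lemma L_deriv:
  assumes "x \<in> V"
  shows "((\<lambda>x. L (a - \<bar>x\<bar>)) has_real_derivative
     sgn x * pq * slope x * (1 + (slope x)\<^sup>2) * (damp x)\<^sup>2 * recip x) (at x)"
proof -
  define p where "p = 4 * H\<^sup>2 / \<kappa>"
  define q where "q = 4 * \<tau>\<^sup>2 / \<kappa>"
  have L: "L (a - \<bar>x\<bar>) = sqrt ((1 - p * (slope x)\<^sup>2) * damp x)" for x
    by (simp add: lam_def slope_def damp_def real_sqrt_divide p_def)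
  have pos: "(1 - p * (slope x)\<^sup>2) * damp x > 0"
    using L_pos_V[OF assms] unfolding L by simp
  have dq: "damp x * (1 + q * (slope x)\<^sup>2) = 1"
    using damp_pos[of x] by (auto simp: damp_def q_def)
  define t m where "t = slope x" and "m = damp x"
  have "((\<lambda>x. (1 - p * (slope x)\<^sup>2) * damp x) has_real_derivative
     2 * p * t * (sgn x * (1 + t\<^sup>2)) * m + (1 - p * t\<^sup>2) * (2 * q * sgn x * t * (1 + t\<^sup>2) * m\<^sup>2)) (at x)"
    unfolding t_def m_def q_def
    by (auto intro!: derivative_eq_intros slope_deriv[OF assms] damp_deriv[OF assms])
  moreover have "2 * p * t * (sgn x * (1 + t\<^sup>2)) * m + (1 - p * t\<^sup>2) * (2 * q * sgn x * t * (1 + t\<^sup>2) * m\<^sup>2)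
    = 2 * sgn x * t * (1 + t\<^sup>2) * m * (p * (m * (1 + q * t\<^sup>2)) + (1 - p * t\<^sup>2) * q * m)"
    using dq unfolding t_def[symmetric] m_def[symmetric] by (simp add: algebra_simps power2_eq_square)
  \<comment> \<open>The mixed terms in \<open>p * q\<close> cancel.\<close>
  moreover have "p * (m * (1 + q * t\<^sup>2)) + (1 - p * t\<^sup>2) * q * m = pq * m"
    unfolding pq_def p_def[symmetric] q_def[symmetric] by (simp add: algebra_simps)
  ultimately have "((\<lambda>x. (1 - p * (slope x)\<^sup>2) * damp x) has_real_derivative
     2 * sgn x * t * (1 + t\<^sup>2) * m * (pq * m)) (at x)"
    by simp
  then have deriv: "((\<lambda>x. sqrt ((1 - p * (slope x)\<^sup>2) * damp x)) has_real_derivative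
     inverse (sqrt ((1 - p * (slope x)\<^sup>2) * damp x)) / 2 * (2 * sgn x * t * (1 + t\<^sup>2) * m * (pq * m))) (at x)"
    by (rule DERIV_chain2[where f = sqrt and g = "\<lambda>x. (1 - p * (slope x)\<^sup>2) * damp x", OF DERIV_real_sqrt[OF pos]])
  have recip: "inverse (sqrt ((1 - p * (slope x)\<^sup>2) * damp x)) = recip x"
    unfolding recip_def L by (rule inverse_eq_divide)
  have "R / 2 * (2 * sgn x * t * (1 + t\<^sup>2) * m * (pq * m)) = sgn x * pq * t * (1 + t\<^sup>2) * m\<^sup>2 * R" for R
    by (simp add: power2_eq_square)
  then show ?thesis
    using deriv unfolding recip L by (simp only: t_def m_def)
qed

lemma recip_deriv:
  assumes "x \<in> V"
  shows "(recip has_real_derivative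
     - (sgn x * pq * slope x * (1 + (slope x)\<^sup>2) * (damp x)\<^sup>2 * recip x ^ 3)) (at x)"
proof -
  have "L (a - \<bar>x\<bar>) \<noteq> 0" using L_pos_V[OF assms] by simp
  from DERIV_inverse_fun[OF L_deriv[OF assms] this]
  show ?thesis
    unfolding recip_def[abs_def] by (simp add: divide_inverse power3_eq_cube power2_eq_square mult_ac)
qed

lemma height_deriv:
  assumes "x \<in> V"
  shows "(height has_real_derivative pq * slope x * (1 + (slope x)\<^sup>2) * (damp x)\<^sup>2 * recip x) (at x)"
proof -
  have "sgn x * sgn x = 1" using V_simps(2)[OF assms] by (simp add: sgn_if)
  then show ?thesis
    unfolding height_def[abs_def]
    by (intro DERIV_cong[OF DERIV_mult[OF sgn_deriv[OF V_simps(2)[OF assms]] L_deriv[OF assms]]])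
      algebra
qed

text \<open>On \<open>V\<close> these four functions satisfy a polynomial system of differential equations.\<close>

lemma Ck_on_coefficients:
  "Ck_on k V sgn \<and> Ck_on k V slope \<and> Ck_on k V damp \<and> Ck_on k V recip"
proof (induction k)
  case 0
  show ?case
    unfolding Ck_on.simps
    by (intro conjI continuous_at_imp_continuous_on ballI;
        rule DERIV_isCont, erule sgn_deriv[OF V_simps(2)] slope_deriv damp_deriv recip_deriv)
next
  case (Suc k)
  then have *: "Ck_on k V sgn" "Ck_on k V slope" "Ck_on k V damp" "Ck_on k V recip" by blast+
  have minus: "Ck_on k V (\<lambda>x. - f x)" if "Ck_on k V f" for f :: "real \<Rightarrow> real"
    using Ck_on_mult[OF V_simps(1) Ck_on_const[OF V_simps(1), of k "-1"] that] by simp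
  show ?case
  proof (intro conjI)
    show "Ck_on (Suc k) V sgn"
      by (rule Ck_on_SucI_real[OF V_simps(1) sgn_deriv[OF V_simps(2)]]) (assumption, rule Ck_on_const[OF V_simps(1)])
    show "Ck_on (Suc k) V slope"
      by (rule Ck_on_SucI_real[OF V_simps(1) slope_deriv]) (assumption, (rule Ck_on_intros V_simps(1) minus *)+)
    show "Ck_on (Suc k) V damp"
      by (rule Ck_on_SucI_real[OF V_simps(1) damp_deriv]) (assumption, (rule Ck_on_intros V_simps(1) minus *)+)
    show "Ck_on (Suc k) V recip"
      by (rule Ck_on_SucI_real[OF V_simps(1) recip_deriv]) (assumption, (rule Ck_on_intros V_simps(1) minus *)+)
  qed
qed

lemma smooth_height: "smooth_on_open V height"
proof -
  have "Ck_on (Suc k) V height" for k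
    by (rule Ck_on_SucI_real[OF V_simps(1) height_deriv])
      (assumption, (rule Ck_on_intros V_simps(1) | use Ck_on_coefficients[of k] in blast)+)
  then show ?thesis
    unfolding smooth_on_open_def using V_simps(1) Ck_on_pred by blast
qed

lemma deriv_height: "x \<in> V \<Longrightarrow> deriv height x \<noteq> 0"
proof -
  assume x: "x \<in> V"
  have "recip x > 0" using L_pos_V[OF x] by (simp add: recip_def)
  then have "pq * slope x * (1 + (slope x)\<^sup>2) * (damp x)\<^sup>2 * recip x > 0"
    using pq_pos slope_pos[OF x] damp_pos[of x]
    by (intro mult_pos_pos) (auto intro: add_pos_nonneg)
  then show ?thesis using DERIV_imp_deriv[OF height_deriv[OF x]] by (metis less_irrefl)
qed

lemma given_by_F: "sphere_immersion_given_by a (Phi \<kappa> \<tau> H) F"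
  unfolding sphere_immersion_given_by_def
proof (rule conjI[OF immersion_F], rule exI[of _ height], rule conjI[OF homeomorphism_height], intro conjI ballI)
  show "smooth_on_open ({- a<..<a} - {0}) height"
    using smooth_height by (simp add: V_def)
  show "deriv height x \<noteq> 0" if "x \<in> {- a<..<a} - {0}" for x
    using deriv_height that by (simp add: V_def)
  show "Phi \<kappa> \<tau> H (x, t) = F (sphere_coords height (x, t))" if "x \<in> {- a<..<a}" for x t
    using that by (intro Phi_eq) auto
qed

section \<open>The embedding criterion\<close>

lemma continuous_on_F: "continuous_on S2 F"
  using smooth_F unfolding smooth_on_S2_def smooth_on_open_def
  by (metis Ck_on.simps(1) continuous_on_subset)

lemma continuous_on_Phi: "continuous_on ({-a..a} \<times> {-pi..pi}) (Phi \<kappa> \<tau> H)"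
proof -
  have "continuous_on ({-a..a} \<times> {-pi..pi}) (\<lambda>p. height (fst p))"
    by (rule continuous_on_compose2[OF continuous_on_height continuous_on_fst[OF continuous_on_id]]) auto
  then have "continuous_on ({-a..a} \<times> {-pi..pi}) (sphere_coords height)"
    unfolding sphere_coords_def case_prod_unfold by (intro continuous_intros)
  moreover have "sphere_coords height ` ({-a..a} \<times> {-pi..pi}) \<subseteq> S2"
    using sphere_coords_in_S2[where g = height, OF height_bounds] by fastforce
  ultimately have "continuous_on ({-a..a} \<times> {-pi..pi}) (\<lambda>p. F (sphere_coords height p))"
    by (rule continuous_on_compose2[OF continuous_on_F])
  then show ?thesis
    by (rule continuous_on_eq) (use Phi_eq in auto)
qed

text \<open>By \<open>inj_on_iff_fibres\<close> injectivity of any sphere given by \<Phi> is one and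
  the same condition on \<Phi>, so it can be tested on the explicit \<open>F\<close>.\<close>

lemma embedding_iff_inj_on_F:
  assumes "sphere_immersion_given_by a (Phi \<kappa> \<tau> H) F'"
  shows "sphere_embedding F' \<longleftrightarrow> inj_on F S2"
proof -
  note char = inj_on_iff_fibres[OF a_bounds(1) _ _ continuous_on_Phi]
  have fibres: "inj_on f S2 \<longleftrightarrow> (\<forall>x\<in>{-a..a}. \<forall>t\<in>{-pi..pi}. \<forall>x'\<in>{-a..a}. \<forall>t'\<in>{-pi..pi}.
    Phi \<kappa> \<tau> H (x, t) = Phi \<kappa> \<tau> H (x', t') \<longrightarrow> x = x' \<and> (\<bar>x\<bar> = a \<or> exp (\<i> * of_real t) = exp (\<i> * of_real t')))"
    if f: "sphere_immersion_given_by a (Phi \<kappa> \<tau> H) f" for f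
  proof -
    obtain h k where h: "homeomorphism {-a<..<a} {-1<..<1} h k"
      and eq: "\<forall>x\<in>{-a<..<a}. \<forall>t\<in>{-pi<..<pi}. Phi \<kappa> \<tau> H (x, t) = f (sphere_coords h (x, t))"
      using f unfolding sphere_immersion_given_by_def by blast
    have "continuous_on S2 f"
      using f unfolding sphere_immersion_given_by_def sphere_immersion_def smooth_on_S2_def smooth_on_open_def
      by (metis Ck_on.simps(1) continuous_on_subset)
    then show ?thesis
      by (intro char[OF h]) (use eq in auto)
  qed
  have immersion: "sphere_immersion F'" using assms by (simp add: sphere_immersion_given_by_def)
  show ?thesis
    unfolding sphere_embedding_iff_inj_on[OF immersion] fibres[OF assms] fibres[OF given_by_F] by (rule refl)
qed

text \<open>The identity \<open>\<tau>^2 D - d (H^2 + \<tau>^2 h^2) = \<kappa> P\<close> of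
  \<open>z_deriv\<close> again makes the numerator constant.\<close>

lemma Y_deriv:
  assumes "D h > 0"
  shows "(Y has_real_derivative - (\<kappa> * H * P / (\<tau> * (H\<^sup>2 + \<tau>\<^sup>2 * h\<^sup>2) * D h))) (at h)"
proof -
  have q: "H\<^sup>2 + \<tau>\<^sup>2 * h\<^sup>2 \<noteq> 0" using sq_sum_pos[of h] by simp
  have "((\<lambda>h. \<tau> / H * h) has_real_derivative \<tau> / H) (at h)"
    using H by (auto intro!: derivative_eq_intros)
  from DERIV_add[OF DERIV_minus[OF DERIV_chain2[OF DERIV_arctan this]] \<beta>_deriv[OF assms]]
  have "(Y has_real_derivative - (inverse (1 + (\<tau> / H * h)\<^sup>2) * (\<tau> / H)) + H / \<tau> * d / D h) (at h)"
    by (simp add: Y_def[abs_def])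
  moreover have "inverse (1 + (\<tau> / H * h)\<^sup>2) * (\<tau> / H) = \<tau> * H / (H\<^sup>2 + \<tau>\<^sup>2 * h\<^sup>2)"
    using H q by (simp add: field_simps power2_eq_square)
  moreover have "- (\<tau> * H / (H\<^sup>2 + \<tau>\<^sup>2 * h\<^sup>2)) + H / \<tau> * d / D h = - (\<kappa> * H * P / (\<tau> * (H\<^sup>2 + \<tau>\<^sup>2 * h\<^sup>2) * D h))"
  proof -
    have "- (\<tau>\<^sup>2 * H * D h) + H * d * (H\<^sup>2 + \<tau>\<^sup>2 * h\<^sup>2) = - (\<kappa> * H * P)"
      by (simp add: D_def P_def d_def algebra_simps power2_eq_square)
    moreover have "- (\<tau> * H / (H\<^sup>2 + \<tau>\<^sup>2 * h\<^sup>2)) + H / \<tau> * d / D h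
      = (- (\<tau>\<^sup>2 * H * D h) + H * d * (H\<^sup>2 + \<tau>\<^sup>2 * h\<^sup>2)) / (\<tau> * (H\<^sup>2 + \<tau>\<^sup>2 * h\<^sup>2) * D h)"
      using q tau assms by (simp add: add_divide_distrib diff_divide_distrib power2_eq_square)
    ultimately show ?thesis by simp
  qed
  ultimately show ?thesis by simp
qed

text \<open>\<open>Y\<close> normalised to increase for either sign of \<tau>.\<close>

definition angle :: "real \<Rightarrow> real" where "angle h = - (sgn \<tau> * Y h)"

lemma angle_0: "angle 0 = 0"
  by (simp add: angle_def Y_def \<beta>_def)

lemma Y_angle: "Y h = - (sgn \<tau> * angle h)"
  using tau by (simp add: angle_def sgn_if)

lemma angle_deriv: "D h > 0 \<Longrightarrow> \<exists>y. (angle has_real_derivative y) (at h) \<and> y > 0"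
proof (intro exI conjI)
  assume h: "D h > 0"
  show "(angle has_real_derivative \<kappa> * H * P / (\<bar>\<tau>\<bar> * (H\<^sup>2 + \<tau>\<^sup>2 * h\<^sup>2) * D h)) (at h)"
    unfolding angle_def[abs_def]
    by (rule DERIV_cong[OF DERIV_minus[OF DERIV_cmult[OF Y_deriv[OF h]]]])
      (use tau in \<open>simp add: sgn_if\<close>)
  show "\<kappa> * H * P / (\<bar>\<tau>\<bar> * (H\<^sup>2 + \<tau>\<^sup>2 * h\<^sup>2) * D h) > 0"
    using kappa H P_pos tau sq_sum_pos[of h] h by simp
qed

lemma angle_mono: "0 \<le> h \<Longrightarrow> h < h' \<Longrightarrow> h' \<le> 1 \<Longrightarrow> angle h < angle h'"
  by (rule DERIV_pos_imp_increasing) (auto intro!: angle_deriv D_pos)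

text \<open>At opposite heights \<open>z\<close> has equal moduli and opposite phases, so equality
  means that \<open>2 Y h\<close> is a multiple of \<open>2 pi\<close>.\<close>

lemma z_symmetric_iff:
  assumes "D h > 0"
  shows "z h = z (- h) \<longleftrightarrow> (\<exists>n::int. Y h = of_int n * pi)"
proof -
  define \<rho> where "\<rho> = 2 * sqrt (H\<^sup>2 + \<tau>\<^sup>2 * h\<^sup>2) * s h"
  have "\<rho> \<noteq> 0" using sq_sum_pos[of h] s_pos[OF assms] by (simp add: \<rho>_def)
  moreover have "z h = of_real \<rho> * exp (- (\<i> * of_real (Y h)))" "z (- h) = of_real \<rho> * exp (\<i> * of_real (Y h))"
    by (simp_all add: z_polar \<rho>_def Y_minus[OF assms])
  ultimately have "z h = z (- h) \<longleftrightarrow> exp (- (\<i> * of_real (Y h))) = exp (\<i> * of_real (Y h))"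
    by simp
  also have "\<dots> \<longleftrightarrow> exp (\<i> * of_real (2 * Y h)) = 1"
  proof -
    have "exp (\<i> * of_real (2 * Y h)) = exp (\<i> * of_real (Y h)) / exp (- (\<i> * of_real (Y h)))"
      by (simp add: mult.left_commute flip: exp_diff)
    then show ?thesis by (auto simp: divide_eq_eq)
  qed
  also have "\<dots> \<longleftrightarrow> (\<exists>n::int. Y h = of_int n * pi)"
    unfolding exp_eq_1 by auto
  finally show ?thesis .
qed

lemma inj_on_F_iff: "inj_on F S2 \<longleftrightarrow> angle 1 < pi"
proof
  assume inj: "inj_on F S2"
  show "angle 1 < pi"
  proof (rule ccontr)
    assume "\<not> angle 1 < pi"
    \<comment> \<open>\<open>angle\<close> starts at 0 and ends at or above \<open>pi\<close>, so it
      takes the value \<open>pi\<close> at a positive height.\<close>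
    moreover have "continuous_on {0..1} angle"
      using angle_deriv D_pos by (intro continuous_at_imp_continuous_on ballI) (metis DERIV_isCont abs_of_nonneg atLeastAtMost_iff)
    ultimately obtain h where h: "0 \<le> h" "h \<le> 1" "angle h = pi"
      using IVT'[of angle 0 pi 1] angle_0 by auto
    have "h \<noteq> 0" using h angle_0 by auto
    have "D h > 0" using h by (intro D_pos) auto
    have "Y h = of_int (if \<tau> > 0 then -1 else 1) * pi"
      using tau h(3) by (simp add: Y_angle sgn_if)
    then have "z h = z (- h)"
      unfolding z_symmetric_iff[OF \<open>D h > 0\<close>] by blast
    \<comment> \<open>\<open>w\<close> is even, so reflected points with the same \<zeta> have one
      image; for \<open>h = 1\<close> these are the two poles.\<close>
    then have "F (of_real (sqrt (1 - h\<^sup>2)), h) = F (of_real (sqrt (1 - h\<^sup>2)), - h)"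
      by (simp add: F_def w_def)
    moreover have "(of_real (sqrt (1 - h\<^sup>2)), h) \<in> S2" "(of_real (sqrt (1 - h\<^sup>2)), - h) \<in> S2"
      using h by (simp_all add: norm_Pair abs_square_le_1)
    ultimately have "h = - h" using inj_onD[OF inj] by blast
    then show False using \<open>h \<noteq> 0\<close> by simp
  qed
next
  assume lt: "angle 1 < pi"
  have not_sym: "z h \<noteq> z (- h)" if h: "0 < h" "h \<le> 1" for h
  proof
    assume "z h = z (- h)"
    then obtain n :: int where n: "Y h = of_int n * pi"
      using z_symmetric_iff[of h] D_pos[of h] h by auto
    have "0 < angle h" "angle h < pi"
      using angle_mono[of 0 h] angle_mono[of h 1] angle_0 lt h by (cases "h = 1"; auto)+
    then have "\<bar>Y h\<bar> < 1 * pi" "Y h \<noteq> 0" using tau by (auto simp: Y_angle sgn_if)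
    then have "\<bar>real_of_int n\<bar> < 1" "n \<noteq> 0" unfolding n abs_mult by auto
    then show False by linarith
  qed
  show "inj_on F S2"
  proof (rule inj_onI)
    fix p q assume pq: "p \<in> S2" "q \<in> S2" and eq: "F p = F q"
    obtain \<zeta> h \<zeta>' h' where p: "p = (\<zeta>, h)" and q: "q = (\<zeta>', h')" by (metis surj_pair)
    have hb: "\<bar>h\<bar> \<le> 1" "\<bar>h'\<bar> \<le> 1" using S2_height pq p q by auto
    have D: "D h > 0" "D h' > 0" using hb D_pos by auto
    have z: "z h = z h'" and w: "w h * \<zeta> = w h' * \<zeta>'" using eq by (simp_all add: F_def p q)
    \<comment> \<open>The modulus of \<open>z\<close> determines the square of the height, which
      leaves only reflected pairs.\<close>
    have "4 * (H\<^sup>2 + \<tau>\<^sup>2 * h\<^sup>2) / D h = 4 * (H\<^sup>2 + \<tau>\<^sup>2 * h'\<^sup>2) / D h'"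
      using norm_z_sq[OF D(1)] norm_z_sq[OF D(2)] z by simp
    then have "(H\<^sup>2 + \<tau>\<^sup>2 * h\<^sup>2) * D h' = (H\<^sup>2 + \<tau>\<^sup>2 * h'\<^sup>2) * D h"
      using D by (simp add: field_simps)
    then have "\<kappa> * P * (h\<^sup>2 - h'\<^sup>2) = 0"
      by (simp add: D_def P_def d_def algebra_simps)
    then have "h\<^sup>2 = h'\<^sup>2" using kappa P_pos by simp
    then have h: "h' = h \<or> h' = - h" by (auto simp: power2_eq_iff)
    have "h' = h"
    proof (rule ccontr)
      assume "h' \<noteq> h"
      then have "h' = - h" "h \<noteq> 0" using h by auto
      then show False
        using z not_sym[of h] not_sym[of "- h"] hb by (cases "h > 0") auto
    qed
    moreover have "w h \<noteq> 0" using s_pos[OF D(1)] kappa by (simp add: w_def)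
    ultimately show "p = q" using w by (simp add: p q)
  qed
qed

text \<open>As \<lambda> is 1 at 0, y at 0 is \<open>Y 1\<close>, that is
  \<open>- sgn \<tau> * angle 1\<close>. For negative \<tau> this value is positive, so the bound to
  be tested is \<open>pi\<close>.\<close>

lemma embedding_iff:
  assumes "sphere_immersion_given_by a (Phi \<kappa> \<tau> H) F'"
  shows "\<tau> > 0 \<Longrightarrow> sphere_embedding F' \<longleftrightarrow> y_profile \<kappa> \<tau> H 0 > - pi"
    and "\<tau> < 0 \<Longrightarrow> sphere_embedding F' \<longleftrightarrow> y_profile \<kappa> \<tau> H 0 < pi"
  unfolding embedding_iff_inj_on_F[OF assms] inj_on_F_iff y_profile_eq L_0 Y_angle
  by (auto simp: sgn_if)

end

text \<open>Different height functions may give different maps \<open>F\<close> for the same \<Phi>;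
  the criterion is therefore stated for every one of them, with the bound matched to the sign of
  \<tau>.\<close>

theorem corollary1:
  fixes \<kappa> \<tau> H :: real
  assumes "\<kappa> > 0" and "\<tau> \<noteq> 0" and "\<kappa> \<noteq> 4 * \<tau>\<^sup>2" and "H > 0"
  shows "(\<exists>F. sphere_immersion_given_by (a_bound \<kappa> H) (Phi \<kappa> \<tau> H) F \<and>
              has_constant_mean_curvature \<kappa> \<tau> F H) \<and>
         (\<forall>F. sphere_immersion_given_by (a_bound \<kappa> H) (Phi \<kappa> \<tau> H) F \<longrightarrow>
              (\<tau> > 0 \<longrightarrow> (sphere_embedding F \<longleftrightarrow> y_profile \<kappa> \<tau> H 0 > - pi)) \<and>
              (\<tau> < 0 \<longrightarrow> (sphere_embedding F \<longleftrightarrow> y_profile \<kappa> \<tau> H 0 < pi)))"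
proof -
  interpret cmc_sphere \<kappa> \<tau> H
    using assms by unfold_locales auto
  show ?thesis
    using given_by_F cmc_F embedding_iff by blast
qed

end
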